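(* Let $n\ge 3$, let $K$ be a field, and let $I=I_{n-2}(C_n)\subset K[x_1,\ldots,x_n]$ be the $(n-2)$-path ideal of the $n$-cycle. Let $\mathrm{HS}(R(I))$ denote the Hilbert series, in the variable $z$, of the Rees algebra $R(I)$. Then: (a) if $n=2s+1$, we have $$\mathrm{HS}(R(I))=\frac{\sum_{k=0}^{s-1}(1+z)^{2k+1}z^{s-1-k}+z^s}{(1-z)^{2s+2}};$$ (b) if $n=2s$, we have $$\mathrm{HS}(R(I))=\frac{\sum_{k=0}^{s-1}(1+z)^{2k}z^{s-1-k}}{(1-z)^{2s+1}}.$$
   Context: $I_{n-2}(C_n)$ is the ideal of $S=K[x_1,\ldots,x_n]$ generated by the monomials $u_j=x_jx_{j+1}\cdots x_{j+n-3}$, $j=1,\ldots,n$, with indices modulo $n$. The Rees algebra is $R(I)=S[u_1\sigma,\ldots,u_n\sigma]\subset S[\sigma]$ with $\sigma$ a new variable. It is standard graded by giving each generator $x_i$ and each generator $u_j\sigma$ degree $1$ (the total degree of the bigrading $\deg x_i=(1,0)$, $\deg u_j\sigma=(0,1)$), and $\mathrm{HS}(R(I))=\sum_{i\ge 0}\dim_K R(I)_i\,z^i$ for this grading. *)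

theory Defs
  imports
    "HOL-Library.Poly_Mapping"
    "HOL-Computational_Algebra.Polynomial"
    "HOL-Computational_Algebra.Formal_Power_Series"
begin

text \<open>Polynomials over \<open>K\<close> in variables indexed by \<open>nat\<close>; the ring \<open>S[\<sigma>]\<close> consists of the univariate
  polynomials (in \<open>\<sigma>\<close>) over these.\<close>

type_synonym 'k mpol = "(nat \<Rightarrow>\<^sub>0 nat) \<Rightarrow>\<^sub>0 'k"

text \<open>The variables of \<open>S = K[x\<^sub>1, \<dots>, x\<^sub>n]\<close> are indexed by the residues \<open>0, \<dots>, n - 1\<close>
  modulo \<open>n\<close>, so \<open>x\<^sub>n\<close> is the variable with index \<open>0\<close>.\<close>

definition polys :: "nat \<Rightarrow> 'k::field mpol set"
  where "polys n = {p. \<forall>m\<in>Poly_Mapping.keys p. Poly_Mapping.keys m \<subseteq> {..<n}}"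

definition var :: "nat \<Rightarrow> 'k::field mpol"
  where "var i = Poly_Mapping.single (Poly_Mapping.single i 1) 1"

definition path_mon :: "nat \<Rightarrow> nat \<Rightarrow> 'k::field mpol"
  where "path_mon n j = (\<Prod>k<n - 2. var ((j + k) mod n))"

definition gen_x :: "nat \<Rightarrow> 'k::field mpol poly"
  where "gen_x i = [:var i:]"

definition gen_u :: "nat \<Rightarrow> nat \<Rightarrow> 'k::field mpol poly"
  where "gen_u n j = [:0, path_mon n j:]"

text \<open>The Rees algebra \<open>S[u\<^sub>1\<sigma>, \<dots>, u\<^sub>n\<sigma>] \<subseteq> S[\<sigma>]\<close> of the ideal generated by the path monomials.\<close>

inductive_set rees_algebra :: "nat \<Rightarrow> 'k::field mpol poly set" for n :: nat where
  base: "p \<in> polys n \<Longrightarrow> [:p:] \<in> rees_algebra n"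
| gen: "j < n \<Longrightarrow> gen_u n j \<in> rees_algebra n"
| add: "f \<in> rees_algebra n \<Longrightarrow> g \<in> rees_algebra n \<Longrightarrow> f + g \<in> rees_algebra n"
| mult: "f \<in> rees_algebra n \<Longrightarrow> g \<in> rees_algebra n \<Longrightarrow> f * g \<in> rees_algebra n"

definition scaleK :: "'k::field \<Rightarrow> 'k mpol poly \<Rightarrow> 'k mpol poly"
  where "scaleK c f = smult (Poly_Mapping.single 0 c) f"

interpretation rees: vector_space "scaleK :: 'k::field \<Rightarrow> _"
proof
  fix a b :: 'k and f g :: "'k mpol poly"
  show "scaleK a (f + g) = scaleK a f + scaleK a g"
    by (simp add: scaleK_def smult_add_right)
  show "scaleK (a + b) f = scaleK a f + scaleK b f"
    by (simp add: scaleK_def smult_add_left single_add)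
  show "scaleK a (scaleK b f) = scaleK (a * b) f"
    by (simp add: scaleK_def mult_single)
  show "scaleK 1 f = f"
    by (simp add: scaleK_def)
qed

text \<open>The bihomogeneous component of degree \<open>(a, b)\<close> for \<open>deg x\<^sub>i = (1, 0)\<close> and
  \<open>deg u\<^sub>j\<sigma> = (0, 1)\<close>: the \<open>K\<close>-span of the products of \<open>a\<close> generators \<open>x\<^sub>i\<close> and
  \<open>b\<close> generators \<open>u\<^sub>j\<sigma>\<close>.\<close>

definition rees_bicomp :: "nat \<Rightarrow> nat \<Rightarrow> nat \<Rightarrow> 'k::field mpol poly set"
  where "rees_bicomp n a b = rees.span
    {(\<Prod>i<n. gen_x i ^ \<alpha> i) * (\<Prod>j<n. gen_u n j ^ \<beta> j) |\<alpha> \<beta>.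
      (\<Sum>i<n. \<alpha> i) = a \<and> (\<Sum>j<n. \<beta> j) = b}"

definition rees_comp :: "nat \<Rightarrow> nat \<Rightarrow> 'k::field mpol poly set"
  where "rees_comp n d = rees.span (\<Union>a\<le>d. rees_bicomp n a (d - a))"

text \<open>The type argument records the field \<open>K\<close>. Every \<open>rees_comp n d\<close> is finite dimensional (see
  \<open>rees_comp_finite_span\<close> below), so \<open>rees.dim\<close> does not take its default value \<open>0\<close>.\<close>

definition rees_HS :: "'k::field itself \<Rightarrow> nat \<Rightarrow> rat fps"
  where "rees_HS _ n = Abs_fps (\<lambda>d. of_nat (rees.dim (rees_comp n d :: 'k mpol poly set)))"


text \<open>The following facts show that \<open>rees_comp\<close> is indeed a grading of the Rees algebra.\<close>

abbreviation gprod :: "nat \<Rightarrow> (nat \<Rightarrow> nat) \<Rightarrow> (nat \<Rightarrow> nat) \<Rightarrow> 'k::field mpol poly"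
  where "gprod n \<alpha> \<beta> \<equiv> (\<Prod>i<n. gen_x i ^ \<alpha> i) * (\<Prod>j<n. gen_u n j ^ \<beta> j)"

lemma rees_comp_eq_span:
  "rees_comp n d = rees.span
    {gprod n \<alpha> \<beta> |\<alpha> \<beta>. (\<Sum>i<n. \<alpha> i) + (\<Sum>j<n. \<beta> j) = d}" (is "_ = rees.span ?B")
proof
  have "rees_bicomp n a (d - a) \<subseteq> rees.span ?B" if "a \<le> d" for a
    unfolding rees_bicomp_def using that by (intro rees.span_mono Collect_mono) fastforce
  then show "rees_comp n d \<subseteq> rees.span ?B"
    unfolding rees_comp_def by (intro rees.span_minimal rees.subspace_span) auto
next
  have "?B \<subseteq> (\<Union>a\<le>d. rees_bicomp n a (d - a))"
  proof
    fix f :: "'a mpol poly" assume "f \<in> ?B"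
    then obtain \<alpha> \<beta> where f: "f = gprod n \<alpha> \<beta>" "(\<Sum>i<n. \<alpha> i) + (\<Sum>j<n. \<beta> j) = d" by blast
    have "f \<in> rees_bicomp n (\<Sum>i<n. \<alpha> i) (\<Sum>j<n. \<beta> j)"
      unfolding rees_bicomp_def f(1) by (intro rees.span_base) blast
    moreover have "(\<Sum>j<n. \<beta> j) = d - (\<Sum>i<n. \<alpha> i)" "(\<Sum>i<n. \<alpha> i) \<le> d" using f(2) by auto
    ultimately show "f \<in> (\<Union>a\<le>d. rees_bicomp n a (d - a))" by auto
  qed
  then show "rees.span ?B \<subseteq> rees_comp n d"
    unfolding rees_comp_def by (rule rees.span_mono)
qed

lemma gprod_add: "gprod n \<alpha> \<beta> * gprod n \<alpha>' \<beta>' = gprod n (\<lambda>i. \<alpha> i + \<alpha>' i) (\<lambda>i. \<beta> i + \<beta>' i)"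
  by (simp add: power_add prod.distrib mult_ac)

lemma gprod_cong:
  assumes "\<And>i. i < n \<Longrightarrow> \<alpha> i = \<alpha>' i" "\<And>i. i < n \<Longrightarrow> \<beta> i = \<beta>' i"
  shows "gprod n \<alpha> \<beta> = gprod n \<alpha>' \<beta>'"
  using assms by (intro arg_cong2[where f = "(*)"] prod.cong) auto

lemma rees_comp_finite_span:
  "\<exists>B. finite B \<and> rees_comp n d = rees.span (B :: 'k::field mpol poly set)"
proof (intro exI conjI)
  let ?B = "{gprod n \<alpha> \<beta> |\<alpha> \<beta>. (\<Sum>i<n. \<alpha> i) + (\<Sum>j<n. \<beta> j) = d} :: 'k mpol poly set"
  let ?E = "PiE {..<n} (\<lambda>_. {..d})"
  have "?B \<subseteq> (\<lambda>(\<alpha>, \<beta>). gprod n \<alpha> \<beta>) ` (?E \<times> ?E)"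
  proof
    fix f assume "f \<in> ?B"
    then obtain \<alpha> \<beta> where f: "f = gprod n \<alpha> \<beta>" "(\<Sum>i<n. \<alpha> i) + (\<Sum>j<n. \<beta> j) = d" by blast
    have a: "\<alpha> i \<le> d" if "i < n" for i
      using member_le_sum[of i "{..<n}" \<alpha>] that f(2) by auto
    have b: "\<beta> i \<le> d" if "i < n" for i
      using member_le_sum[of i "{..<n}" \<beta>] that f(2) by auto
    have "f = gprod n (restrict \<alpha> {..<n}) (restrict \<beta> {..<n})"
      unfolding f(1) by (rule gprod_cong) auto
    moreover have "restrict \<alpha> {..<n} \<in> ?E" "restrict \<beta> {..<n} \<in> ?E" using a b by auto
    ultimately show "f \<in> (\<lambda>(\<alpha>, \<beta>). gprod n \<alpha> \<beta>) ` (?E \<times> ?E)"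
      by (intro image_eqI[of _ _ "(restrict \<alpha> {..<n}, restrict \<beta> {..<n})"]) simp_all
  qed
  then show "finite ?B" by (rule finite_subset) (auto intro: finite_PiE)
  show "rees_comp n d = rees.span ?B" by (rule rees_comp_eq_span)
qed

lemma scaleK_mult_left: "scaleK c f * g = scaleK c (f * g)"
  and scaleK_mult_right: "f * scaleK c g = scaleK c (f * g)"
  by (simp_all add: scaleK_def)

lemma span_mult:
  assumes "f \<in> rees.span A" "g \<in> rees.span B" "\<And>a b. a \<in> A \<Longrightarrow> b \<in> B \<Longrightarrow> a * b \<in> C"
  shows "f * g \<in> rees.span C"
  using assms(1)
proof (induction rule: rees.span_induct_alt)
  case base then show ?case by (simp add: rees.span_zero)
next
  case (step c a f)
  have "a * g \<in> rees.span C" using assms(2)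
  proof (induction rule: rees.span_induct_alt)
    case base then show ?case by (simp add: rees.span_zero)
  next
    case (step c' b g)
    then show ?case using assms(3)[of a b] \<open>a \<in> A\<close>
      by (simp add: distrib_left scaleK_mult_right rees.span_add rees.span_scale rees.span_base)
  qed
  then show ?case using step
    by (simp add: distrib_right scaleK_mult_left rees.span_add rees.span_scale)
qed

lemma rees_comp_mult:
  assumes "f \<in> rees_comp n d" "g \<in> rees_comp n e"
  shows "f * g \<in> rees_comp n (d + e)"
  using assms unfolding rees_comp_eq_span
proof (rule span_mult)
  fix a b :: "'a mpol poly"
  assume "a \<in> {gprod n \<alpha> \<beta> |\<alpha> \<beta>. (\<Sum>i<n. \<alpha> i) + (\<Sum>j<n. \<beta> j) = d}"
    and "b \<in> {gprod n \<alpha> \<beta> |\<alpha> \<beta>. (\<Sum>i<n. \<alpha> i) + (\<Sum>j<n. \<beta> j) = e}"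
  then obtain \<alpha> \<beta> \<alpha>' \<beta>' where "a = gprod n \<alpha> \<beta>" "b = gprod n \<alpha>' \<beta>'"
    "(\<Sum>i<n. \<alpha> i) + (\<Sum>j<n. \<beta> j) = d" "(\<Sum>i<n. \<alpha>' i) + (\<Sum>j<n. \<beta>' j) = e" by blast
  then show "a * b \<in> {gprod n \<alpha> \<beta> |\<alpha> \<beta>. (\<Sum>i<n. \<alpha> i) + (\<Sum>j<n. \<beta> j) = d + e}"
    by (intro CollectI exI[of _ "\<lambda>i. \<alpha> i + \<alpha>' i"] exI[of _ "\<lambda>i. \<beta> i + \<beta>' i"])
      (simp add: gprod_add sum.distrib)
qed

lemma const_in_polys: "Poly_Mapping.single 0 c \<in> polys n"
  by (simp add: polys_def)

lemma rees_algebra_subspace: "rees.subspace (rees_algebra n :: 'k::field mpol poly set)"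
proof (rule rees.subspaceI)
  show "0 \<in> (rees_algebra n :: 'k mpol poly set)"
    using rees_algebra.base[OF const_in_polys, of 0 n] by simp
next
  fix c and f :: "'k mpol poly" assume "f \<in> rees_algebra n"
  then show "scaleK c f \<in> rees_algebra n"
    using rees_algebra.mult[OF rees_algebra.base[OF const_in_polys, of c n]]
    by (simp add: scaleK_def)
qed (rule rees_algebra.add)

lemma one_in_rees: "1 \<in> rees_algebra n"
  using rees_algebra.base[OF const_in_polys, of 1 n] by (simp add: one_pCons)

lemma rees_power: "f \<in> rees_algebra n \<Longrightarrow> f ^ k \<in> rees_algebra n"
  by (induction k) (auto intro: rees_algebra.mult one_in_rees)

lemma rees_prod: "(\<And>i. i \<in> A \<Longrightarrow> f i \<in> rees_algebra n) \<Longrightarrow> (\<Prod>i\<in>A. f i) \<in> rees_algebra n"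
  by (induction A rule: infinite_finite_induct) (auto intro: rees_algebra.mult one_in_rees)

lemma gen_x_in_rees: "i < n \<Longrightarrow> gen_x i \<in> rees_algebra n"
  unfolding gen_x_def by (rule rees_algebra.base) (simp add: polys_def var_def)

lemma rees_comp_subset: "rees_comp n d \<subseteq> rees_algebra n"
  unfolding rees_comp_eq_span
  by (rule rees.span_minimal)
    (auto intro!: rees_algebra.mult rees_prod rees_power gen_x_in_rees rees_algebra.gen
      rees_algebra_subspace)

lemma var_power: "var i ^ k = Poly_Mapping.single (Poly_Mapping.single i k) 1"
  by (induction k) (simp_all add: var_def mult_single single_add[symmetric])

lemma const_poly_prod: "(\<Prod>i\<in>A. [:f i:]) = [:\<Prod>i\<in>A. f i:]"
  by (induction A rule: infinite_finite_induct) (simp_all add: one_pCons mult.commute)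

lemma const_poly_power: "[:c:] ^ k = [:c ^ k:]"
  by (induction k) (simp_all add: one_pCons mult.commute)

lemma single_prod:
  "finite A \<Longrightarrow> (\<Prod>i\<in>A. Poly_Mapping.single (f i) (1::'k::field)) = Poly_Mapping.single (\<Sum>i\<in>A. f i) 1"
  by (induction A rule: finite_induct) (simp_all add: mult_single)

lemma mon_expand:
  assumes "Poly_Mapping.keys m \<subseteq> {..<n}"
  shows "[:Poly_Mapping.single m c:] = scaleK c (gprod n (Poly_Mapping.lookup m) (\<lambda>_. 0))"
proof -
  have "m = (\<Sum>i<n. Poly_Mapping.single i (Poly_Mapping.lookup m i))"
  proof (rule poly_mapping_eqI)
    fix k
    have "Poly_Mapping.lookup (\<Sum>i<n. Poly_Mapping.single i (Poly_Mapping.lookup m i)) k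
        = (\<Sum>i<n. if i = k then Poly_Mapping.lookup m i else 0)"
      by (simp add: lookup_sum lookup_single when_def)
    also have "\<dots> = Poly_Mapping.lookup m k" using assms by (auto simp: in_keys_iff subset_iff)
    finally show "Poly_Mapping.lookup m k = Poly_Mapping.lookup (\<Sum>i<n. Poly_Mapping.single i (Poly_Mapping.lookup m i)) k" ..
  qed
  then have "(\<Prod>i<n. Poly_Mapping.single (Poly_Mapping.single i (Poly_Mapping.lookup m i)) 1) = Poly_Mapping.single m (1::'a)"
    by (simp add: single_prod)
  then show ?thesis
    by (simp add: gen_x_def const_poly_power const_poly_prod var_power scaleK_def mult_single)
qed

lemma poly_mapping_sum_single: "p = (\<Sum>m\<in>Poly_Mapping.keys p. Poly_Mapping.single m (Poly_Mapping.lookup p m))"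
  by (rule poly_mapping_eqI)
    (auto simp: lookup_sum lookup_single when_def in_keys_iff)

lemma const_poly_sum: "[:\<Sum>i\<in>A. f i:] = (\<Sum>i\<in>A. [:f i:])"
proof (induction A rule: infinite_finite_induct)
  case (insert a A)
  have "[:f a + sum f A:] = [:f a:] + [:sum f A:]" by simp
  then show ?case unfolding sum.insert[OF insert.hyps] insert.IH .
qed simp_all

lemma rees_algebra_eq_span:
  "rees_algebra n = rees.span (\<Union>d. rees_comp n d)" (is "_ = ?R")
proof
  show "?R \<subseteq> rees_algebra n"
    by (rule rees.span_minimal[OF _ rees_algebra_subspace]) (use rees_comp_subset in blast)
  have g: "gprod n \<alpha> \<beta> \<in> ?R" for \<alpha> \<beta>
    by (rule rees.span_base) (auto simp: rees_comp_eq_span intro!: rees.span_base)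
  show "rees_algebra n \<subseteq> ?R"
  proof
    fix f :: "'a mpol poly" assume "f \<in> rees_algebra n"
    then show "f \<in> ?R"
    proof induction
      case (base p)
      have "[:p:] = (\<Sum>m\<in>Poly_Mapping.keys p. [:Poly_Mapping.single m (Poly_Mapping.lookup p m):])"
        by (subst poly_mapping_sum_single) (rule const_poly_sum)
      also have "\<dots> \<in> ?R"
      proof (rule rees.span_sum)
        fix m assume "m \<in> Poly_Mapping.keys p"
        then have "Poly_Mapping.keys m \<subseteq> {..<n}" using base by (simp add: polys_def)
        then show "[:Poly_Mapping.single m (Poly_Mapping.lookup p m):] \<in> ?R"
          by (simp only: mon_expand rees.span_scale g)
      qed
      finally show ?case .
    next
      case (gen j)
      have "gprod n (\<lambda>_. 0) (\<lambda>i. if i = j then 1 else 0) = (\<Prod>i<n. if i = j then gen_u n i else 1 :: 'a mpol poly)"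
        unfolding power_0 prod.neutral_const mult_1 by (rule prod.cong) simp_all
      also have "\<dots> = gen_u n j" using gen by (simp add: prod.delta)
      finally have "(gen_u n j :: 'a mpol poly) = gprod n (\<lambda>_. 0) (\<lambda>i. if i = j then 1 else 0)" by (rule sym)
      then show ?case by (simp only: g)
    next
      case (add f g)
      show ?case by (rule rees.span_add) (fact add.IH)+
    next
      case (mult f g)
      show ?case
        by (rule span_mult[OF mult.IH]) (use rees_comp_mult in blast)
    qed
  qed
qed

text \<open>Directness of the sum: the components lie in the homogeneous components of \<open>S[\<sigma>]\<close> for
  \<open>deg x\<^sub>i = 1\<close> and \<open>deg \<sigma> = 3 - n\<close>.\<close>

definition homog :: "nat \<Rightarrow> nat \<Rightarrow> 'k::field mpol poly set"
  where "homog n d = {f. \<forall>b. \<forall>m\<in>Poly_Mapping.keys (coeff f b). (\<Sum>i<n. Poly_Mapping.lookup m i) + b = d + (n - 2) * b}"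

lemma keys_sum_subset: "Poly_Mapping.keys (\<Sum>i\<in>A. f i) \<subseteq> (\<Union>i\<in>A. Poly_Mapping.keys (f i))"
proof (induction A rule: infinite_finite_induct)
  case (insert a A)
  then show ?case using Poly_Mapping.keys_add[of "f a" "sum f A"] by auto
qed simp_all

lemma homog_subspace: "rees.subspace (homog n d)"
proof (rule rees.subspaceI)
  fix f g :: "'a mpol poly" assume "f \<in> homog n d" "g \<in> homog n d"
  then show "f + g \<in> homog n d"
    using Poly_Mapping.keys_add by (fastforce simp: homog_def)
next
  fix c and f :: "'a mpol poly" assume *: "f \<in> homog n d"
  have "Poly_Mapping.keys (Poly_Mapping.single 0 c * p) \<subseteq> Poly_Mapping.keys p" for p :: "'a mpol"
    using keys_mult[of "Poly_Mapping.single 0 c" p] by (auto split: if_splits)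
  then show "scaleK c f \<in> homog n d"
    using * by (force simp: homog_def scaleK_def)
qed (simp add: homog_def)

lemma homog_mult:
  assumes "f \<in> homog n d" "g \<in> homog n e"
  shows "f * g \<in> homog n (d + e)"
  unfolding homog_def
proof (intro CollectI allI ballI)
  fix b m assume "m \<in> Poly_Mapping.keys (coeff (f * g) b)"
  then obtain i where i: "i \<le> b" "m \<in> Poly_Mapping.keys (coeff f i * coeff g (b - i))"
    unfolding coeff_mult using keys_sum_subset by fastforce
  then obtain m1 m2 where m: "m = m1 + m2" "m1 \<in> Poly_Mapping.keys (coeff f i)" "m2 \<in> Poly_Mapping.keys (coeff g (b - i))"
    using keys_mult by fastforce
  have 1: "(\<Sum>i<n. Poly_Mapping.lookup m1 i) + i = d + (n - 2) * i" using assms(1) m(2) by (simp add: homog_def)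
  have 2: "(\<Sum>i<n. Poly_Mapping.lookup m2 i) + (b - i) = e + (n - 2) * (b - i)"
    using assms(2) m(3) by (simp add: homog_def)
  have "(n - 2) * b = (n - 2) * i + (n - 2) * (b - i)"
    using i(1) by (simp add: distrib_left[symmetric])
  then show "(\<Sum>i<n. Poly_Mapping.lookup m i) + b = d + e + (n - 2) * b"
    using 1 2 i(1) unfolding m(1) lookup_add sum.distrib by linarith
qed

lemma homog_one: "1 \<in> homog n 0"
  by (auto simp: homog_def one_pCons coeff_pCons split: nat.splits)

lemma homog_power: "f \<in> homog n d \<Longrightarrow> f ^ k \<in> homog n (d * k)"
  by (induction k) (auto simp: homog_one dest: homog_mult)

lemma homog_prod: "(\<And>i. i \<in> A \<Longrightarrow> f i \<in> homog n (d i)) \<Longrightarrow> (\<Prod>i\<in>A. f i) \<in> homog n (\<Sum>i\<in>A. d i)"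
  by (induction A rule: infinite_finite_induct) (auto simp: homog_one intro: homog_mult)

lemma gen_x_homog: "i < n \<Longrightarrow> gen_x i \<in> homog n 1"
  by (auto simp: homog_def gen_x_def var_def coeff_pCons lookup_single when_def split: nat.splits)

lemma path_mon_eq:
  "path_mon n j = Poly_Mapping.single (\<Sum>k<n - 2. Poly_Mapping.single ((j + k) mod n) 1) 1"
  by (simp add: path_mon_def var_def single_prod)

lemma gen_u_homog:
  assumes "j < n"
  shows "gen_u n j \<in> homog n 1"
proof -
  let ?m = "\<Sum>k<n - 2. Poly_Mapping.single ((j + k) mod n) (1::nat)"
  have "(\<Sum>i<n. Poly_Mapping.lookup ?m i) = (\<Sum>k<n - 2. \<Sum>i<n. if (j + k) mod n = i then 1 else 0)"
    by (subst sum.swap) (simp add: lookup_sum lookup_single when_def cong: if_cong)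
  also have "\<dots> = n - 2" using assms by simp
  finally have "(\<Sum>i<n. Poly_Mapping.lookup ?m i) = n - 2" .
  then show ?thesis
    by (auto simp: homog_def gen_u_def path_mon_eq coeff_pCons split: nat.splits)
qed

lemma rees_comp_homog: "rees_comp n d \<subseteq> homog n d"
  unfolding rees_comp_eq_span
proof (rule rees.span_minimal[OF _ homog_subspace], clarify)
  fix \<alpha> \<beta> :: "nat \<Rightarrow> nat"
  have "gprod n \<alpha> \<beta> \<in> homog n ((\<Sum>i<n. 1 * \<alpha> i) + (\<Sum>j<n. 1 * \<beta> j))"
    by (intro homog_mult homog_prod homog_power) (auto intro: gen_x_homog[simplified] gen_u_homog[simplified])
  then show "gprod n \<alpha> \<beta> \<in> homog n ((\<Sum>i<n. \<alpha> i) + (\<Sum>j<n. \<beta> j))" by simp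
qed

lemma rees_comp_direct:
  assumes "finite D" "\<And>d. d \<in> D \<Longrightarrow> f d \<in> rees_comp n d" "(\<Sum>d\<in>D. f d) = 0" "e \<in> D"
  shows "f e = 0"
proof (rule poly_eqI, rule poly_mapping_eqI)
  fix b m
  show "Poly_Mapping.lookup (coeff (f e) b) m = Poly_Mapping.lookup (coeff 0 b) m"
  proof (rule ccontr)
    assume ne: "\<not> ?thesis"
    have h: "f d \<in> homog n d" if "d \<in> D" for d
      using assms(2)[OF that] rees_comp_homog by blast
    from ne have e: "(\<Sum>i<n. Poly_Mapping.lookup m i) + b = e + (n - 2) * b"
      using h[OF assms(4)] by (auto simp: homog_def in_keys_iff)
    have "Poly_Mapping.lookup (coeff (f d) b) m = 0" if "d \<in> D - {e}" for d
    proof (rule ccontr)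
      assume "Poly_Mapping.lookup (coeff (f d) b) m \<noteq> 0"
      then have "(\<Sum>i<n. Poly_Mapping.lookup m i) + b = d + (n - 2) * b"
        using h[of d] that by (auto simp: homog_def in_keys_iff)
      with e that show False by simp
    qed
    then have "(\<Sum>d\<in>D - {e}. Poly_Mapping.lookup (coeff (f d) b) m) = 0" by (rule sum.neutral[OF ballI])
    then have "Poly_Mapping.lookup (coeff (\<Sum>d\<in>D. f d) b) m = Poly_Mapping.lookup (coeff (f e) b) m"
      using assms(1,4) unfolding coeff_sum lookup_sum by (simp add: sum.remove)
    with ne show False by (simp add: assms(3))
  qed
qed

end

theory Submission
  imports Defs
begin

text \<open>Let \<open>P = x\<^sub>1 \<cdots> x\<^sub>n\<close>. Every path monomial misses exactly two cyclically adjacent variables: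
  \<open>u\<^sub>j = P / (x\<^sub>j\<^sub>-\<^sub>2 x\<^sub>j\<^sub>-\<^sub>1)\<close>. So the Rees algebra has a \<open>K\<close>-basis of monomials, and
  \<open>x\<^sup>m \<sigma>\<^sup>b\<close> belongs to it iff, for \<open>v = m - (b, \<dots>, b)\<close>, one can choose natural weights \<open>\<beta>\<close> on the
  \<open>n\<close> edges of the cycle, of total weight \<open>b\<close>, such that \<open>v\<^sub>i + \<beta>\<^sub>i + \<beta>\<^sub>i\<^sub>-\<^sub>1 \<ge> 0\<close> at every vertex \<open>i\<close>
  (the exponents of the \<open>x\<^sub>i\<close> absorb the surplus). The degree of this monomial is
  \<open>\<Sum>v + 3 b\<close>.

  For fixed \<open>v \<in> \<int>\<^sup>n\<close> the admissible \<open>b\<close> are all \<open>b \<ge> \<tau>(v)\<close>, where \<open>\<tau>(v)\<close> is the least total weight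
  of such a cover; going from \<open>b\<close> to \<open>b + 1\<close> is multiplication by \<open>P \<sigma>\<close>, of degree 3. Hence
  \<open>(1 - z\<^sup>3) HS = \<Sum>\<^sub>v z ^ (\<Sum>v + 3 \<tau>(v))\<close>.

  The sum over \<open>v\<close> is evaluated by the substitution \<open>v\<^sub>i = w\<^sub>i - max(0, - w\<^sub>i\<^sub>-\<^sub>1)\<close> with \<open>w \<in> \<int>\<^sup>n\<close>. The
  weights \<open>\<beta>\<^sub>i = max(0, - w\<^sub>i)\<close> then satisfy \<open>\<beta>\<^sub>i = max(0, - v\<^sub>i - \<beta>\<^sub>i\<^sub>-\<^sub>1)\<close>, that is, they are a greedy
  choice consistent around the cycle. Such a cover is optimal, and the exponent becomes
  \<open>\<Sum> \<bar>w\<^sub>i\<bar>\<close> (\<open>cover_num_balance\<close>, \<open>min_degree_balance\<close>). If the substitution were a bijection of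
  \<open>\<int>\<^sup>n\<close>, the sum would be \<open>((1 + z) / (1 - z))\<^sup>n\<close>. It fails to be one by a term that depends on the
  parity of \<open>n\<close>:

  \<^item> If \<open>n = 2 s\<close>, it is onto, and two preimages of the same \<open>v\<close> differ by a multiple of the
    alternating vector \<open>(1, -1, 1, \<dots>)\<close>. All preimages but one are counted by the vectors \<open>w \<le> 0\<close>
    with negative entries at odd places, which contribute \<open>z\<^sup>s / (1 - z)\<^sup>n\<close> too much.

  \<^item> If \<open>n = 2 s + 1\<close>, it is injective. It misses those \<open>v\<close> whose consistent greedy weights are
    half-integers, \<open>v\<^sub>i = - (\<gamma>\<^sub>i + \<gamma>\<^sub>i\<^sub>-\<^sub>1 + 1)\<close> with \<open>\<gamma> \<ge> 0\<close>. Their exponents are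
    \<open>\<Sum>\<gamma> + s + 2\<close>, so they add \<open>z\<^sup>s\<^sup>+\<^sup>2 / (1 - z)\<^sup>n\<close>.

  The two numerators follow by dividing by \<open>1 - z\<^sup>3 = (1 - z) (1 + z + z\<^sup>2)\<close> and summing a geometric
  series with the two bases \<open>(1 + z)\<^sup>2\<close> and \<open>z\<close>, whose difference is \<open>1 + z + z\<^sup>2\<close>.\<close>

section \<open>Covering integer vectors by edge weights of a cycle\<close>

definition cyc_pred :: "nat \<Rightarrow> nat \<Rightarrow> nat"
  where "cyc_pred n i = (if i = 0 then n - 1 else i - 1)"

lemma cyc_pred_less: "i < n \<Longrightarrow> cyc_pred n i < n"
  by (auto simp: cyc_pred_def)

lemma sum_cyc_pred:
  fixes f :: "nat \<Rightarrow> 'a::comm_monoid_add"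
  shows "(\<Sum>i<n. f (cyc_pred n i)) = (\<Sum>i<n. f i)"
proof (cases n)
  case (Suc k)
  have "(\<Sum>i<Suc k. f (cyc_pred n i)) = f k + (\<Sum>i<k. f i)"
    unfolding sum.lessThan_Suc_shift by (simp add: cyc_pred_def Suc)
  then show ?thesis by (simp add: Suc add.commute)
qed simp

lemma even_if_alternating:
  fixes Q :: "nat \<Rightarrow> bool"
  assumes "0 < n" and alt: "\<And>i. i < n \<Longrightarrow> Q i \<noteq> Q (cyc_pred n i)"
  shows "even n"
proof -
  have "Q i = (if even i then Q 0 else \<not> Q 0)" if "i < n" for i
    using that
  proof (induction i)
    case (Suc i)
    then show ?case using alt[of "Suc i"] by (auto simp: cyc_pred_def)
  qed simp
  from this[of "n - 1"] show ?thesis using alt[of 0] assms(1)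
    by (auto simp: cyc_pred_def split: if_splits)
qed

text \<open>The weight \<open>\<beta> i\<close> sits on the edge between the vertices \<open>i\<close> and \<open>i + 1\<close> of the cycle, so a vertex
  is covered by \<open>\<beta> i\<close> and by \<open>\<beta>\<close> at its predecessor.\<close>

definition covers :: "nat \<Rightarrow> (nat \<Rightarrow> int) \<Rightarrow> (nat \<Rightarrow> nat) \<Rightarrow> bool"
  where "covers n v \<beta> \<longleftrightarrow> (\<forall>i<n. 0 \<le> v i + int (\<beta> i) + int (\<beta> (cyc_pred n i)))"

definition cover_num :: "nat \<Rightarrow> (nat \<Rightarrow> int) \<Rightarrow> nat"
  where "cover_num n v = (LEAST b. \<exists>\<beta>. covers n v \<beta> \<and> (\<Sum>i<n. \<beta> i) = b)"

text \<open>The least degree of a monomial \<open>x\<^sup>m \<sigma>\<^sup>b\<close> of the Rees algebra with \<open>m - (b, \<dots>, b) = v\<close>.\<close>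

definition min_degree :: "nat \<Rightarrow> (nat \<Rightarrow> int) \<Rightarrow> int"
  where "min_degree n v = (\<Sum>i<n. v i) + 3 * int (cover_num n v)"

lemma cover_exists: "\<exists>b \<beta>. covers n v \<beta> \<and> (\<Sum>i<n. \<beta> i) = b"
proof -
  have "covers n v (\<lambda>i. nat \<bar>v i\<bar>)" by (auto simp: covers_def)
  then show ?thesis by blast
qed

lemma cover_num_attained: "\<exists>\<beta>. covers n v \<beta> \<and> (\<Sum>i<n. \<beta> i) = cover_num n v"
  unfolding cover_num_def by (rule LeastI_ex) (rule cover_exists)

lemma cover_num_le: "covers n v \<beta> \<Longrightarrow> cover_num n v \<le> (\<Sum>i<n. \<beta> i)"
  unfolding cover_num_def by (rule Least_le) blast

lemma cover_num_eqI:
  assumes "covers n v \<beta>" "\<And>\<beta>'. covers n v \<beta>' \<Longrightarrow> (\<Sum>i<n. \<beta> i) \<le> (\<Sum>i<n. \<beta>' i)"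
  shows "cover_num n v = (\<Sum>i<n. \<beta> i)"
  using cover_num_attained[of n v] cover_num_le[OF assms(1)] assms(2) by (metis le_antisym)

text \<open>Extra weight on any edge keeps a cover a cover, so the total weights of covers are an up-set.\<close>

lemma cover_iff_ge_cover_num:
  assumes "0 < n"
  shows "(\<exists>\<beta>. covers n v \<beta> \<and> (\<Sum>i<n. \<beta> i) = b) \<longleftrightarrow> cover_num n v \<le> b"
proof
  assume "cover_num n v \<le> b"
  obtain \<beta> where \<beta>: "covers n v \<beta>" "(\<Sum>i<n. \<beta> i) = cover_num n v"
    using cover_num_attained by blast
  let ?\<beta> = "\<lambda>i. \<beta> i + (if i = 0 then b - cover_num n v else 0)"
  have "covers n v ?\<beta>" using \<beta>(1) unfolding covers_def by fastforce
  moreover have "(\<Sum>i<n. ?\<beta> i) = b"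
    using \<beta>(2) \<open>cover_num n v \<le> b\<close> assms by (simp add: sum.distrib)
  ultimately show "\<exists>\<beta>. covers n v \<beta> \<and> (\<Sum>i<n. \<beta> i) = b" by blast
qed (use cover_num_le in blast)

text \<open>The substitution \<open>w \<mapsto> v\<close>: if \<open>w i\<close> is the balance at vertex \<open>i\<close> after the preceding edge has
  delivered its weight, then the next edge must supply the deficit \<open>nat (- w i)\<close>, and the original
  entry at \<open>i\<close> is \<open>w i\<close> minus the deficit of the predecessor.\<close>

definition balance :: "nat \<Rightarrow> (nat \<Rightarrow> int) \<Rightarrow> nat \<Rightarrow> int"
  where "balance n w = (\<lambda>i\<in>{..<n}. w i - int (nat (- w (cyc_pred n i))))"

lemma balance_in_PiE: "balance n w \<in> PiE {..<n} (\<lambda>_. UNIV)"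
  by (auto simp: balance_def)

text \<open>The deficits form a cover. It is optimal because a cover \<open>\<beta>\<close> that puts less weight than the deficit
  on an edge \<open>i\<close> must compensate for it on the preceding edge: the negative part of the difference \<open>\<delta>\<close>
  at \<open>i\<close> is at most its positive part at the predecessor. Summing around the cycle gives
  \<open>\<Sum>\<delta> \<ge> 0\<close>.\<close>

lemma cover_num_balance: "cover_num n (balance n w) = (\<Sum>i<n. nat (- w i))"
proof (rule cover_num_eqI)
  show "covers n (balance n w) (\<lambda>i. nat (- w i))"
    by (auto simp: covers_def balance_def)
next
  fix \<beta> assume \<beta>: "covers n (balance n w) \<beta>"
  define \<delta> where "\<delta> i = int (\<beta> i) - int (nat (- w i))" for i
  have "max 0 (- \<delta> i) \<le> max 0 (\<delta> (cyc_pred n i))" if "i < n" for i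
  proof -
    have "0 \<le> w i - int (nat (- w (cyc_pred n i))) + int (\<beta> i) + int (\<beta> (cyc_pred n i))"
      using \<beta> that by (simp add: covers_def balance_def)
    then show ?thesis unfolding \<delta>_def by linarith
  qed
  then have "(\<Sum>i<n. max 0 (- \<delta> i)) \<le> (\<Sum>i<n. max 0 (\<delta> (cyc_pred n i)))"
    by (intro sum_mono) auto
  also have "\<dots> = (\<Sum>i<n. max 0 (\<delta> i))" by (rule sum_cyc_pred)
  finally have "0 \<le> (\<Sum>i<n. max 0 (\<delta> i) - max 0 (- \<delta> i))" by (simp add: sum_subtractf)
  also have "\<dots> = (\<Sum>i<n. \<delta> i)" by (intro sum.cong) auto
  finally have "int (\<Sum>i<n. nat (- w i)) \<le> int (\<Sum>i<n. \<beta> i)"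
    by (simp add: \<delta>_def sum_subtractf)
  then show "(\<Sum>i<n. nat (- w i)) \<le> (\<Sum>i<n. \<beta> i)" by linarith
qed

lemma min_degree_balance: "min_degree n (balance n w) = (\<Sum>i<n. \<bar>w i\<bar>)"
proof -
  have "(\<Sum>i<n. balance n w i) = (\<Sum>i<n. w i) - (\<Sum>i<n. int (nat (- w (cyc_pred n i))))"
    by (simp add: balance_def sum_subtractf)
  also have "(\<Sum>i<n. int (nat (- w (cyc_pred n i)))) = (\<Sum>i<n. int (nat (- w i)))"
    by (rule sum_cyc_pred)
  finally have "min_degree n (balance n w) = (\<Sum>i<n. w i) + 2 * (\<Sum>i<n. int (nat (- w i)))"
    by (simp add: min_degree_def cover_num_balance)
  also have "\<dots> = (\<Sum>i<n. w i + 2 * int (nat (- w i)))"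
    by (simp add: sum.distrib sum_distrib_left)
  also have "\<dots> = (\<Sum>i<n. \<bar>w i\<bar>)" by (intro sum.cong) auto
  finally show ?thesis .
qed

text \<open>Passing from the deficit at the predecessor of \<open>i\<close> to the deficit at \<open>i\<close> is a 1-Lipschitz map for
  given \<open>v i\<close>. Around the cycle the absolute differences of the deficits of \<open>w\<close> and \<open>w'\<close> can therefore
  only stay constant, which excludes any cutting off at 0 and forces the signs to alternate.\<close>

lemma balance_collision:
  assumes n: "0 < n" and eq: "balance n w = balance n w'" and ne: "\<exists>i<n. w i \<noteq> w' i"
  shows "\<And>i. i < n \<Longrightarrow> w i \<le> 0 \<and> w' i \<le> 0 \<and> w i \<noteq> w' i"
    and "\<And>i. i < n \<Longrightarrow> w i < w' i \<longleftrightarrow> \<not> w (cyc_pred n i) < w' (cyc_pred n i)"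
proof -
  define \<delta> where "\<delta> i = int (nat (- w i)) - int (nat (- w' i))" for i
  have diff: "w i - w' i = \<delta> (cyc_pred n i)" if "i < n" for i
    using fun_cong[OF eq, of i] that by (simp add: balance_def \<delta>_def)
  have le: "\<bar>\<delta> i\<bar> \<le> \<bar>\<delta> (cyc_pred n i)\<bar>" if "i < n" for i
    using diff[OF that] unfolding \<delta>_def by linarith
  have "(\<Sum>i<n. \<bar>\<delta> (cyc_pred n i)\<bar> - \<bar>\<delta> i\<bar>) = 0"
    using sum_cyc_pred[of "\<lambda>i. \<bar>\<delta> i\<bar>" n] by (simp add: sum_subtractf)
  then have tight: "\<bar>\<delta> (cyc_pred n i)\<bar> = \<bar>\<delta> i\<bar>" if "i < n" for i
    using that le by (subst (asm) sum_nonneg_eq_0_iff) auto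
  have const: "\<bar>\<delta> i\<bar> = \<bar>\<delta> 0\<bar>" if "i < n" for i using that
  proof (induction i)
    case (Suc i)
    then show ?case using tight[of "Suc i"] by (simp add: cyc_pred_def)
  qed simp
  obtain k where k: "k < n" "w k \<noteq> w' k" using ne by blast
  have "\<bar>\<delta> 0\<bar> \<noteq> 0" using diff[OF k(1)] k(2) const[OF cyc_pred_less[OF k(1)]] by simp
  then have nz: "\<delta> i \<noteq> 0" if "i < n" for i using const[OF that] by simp
  show *: "w i \<le> 0 \<and> w' i \<le> 0 \<and> w i \<noteq> w' i" if "i < n" for i
    using nz[OF that] tight[OF that] diff[OF that] unfolding \<delta>_def by linarith
  show "w i < w' i \<longleftrightarrow> \<not> w (cyc_pred n i) < w' (cyc_pred n i)" if "i < n" for i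
    using *[OF that] *[OF cyc_pred_less[OF that]] diff[OF that] unfolding \<delta>_def by linarith
qed

lemma PiE_lessThan_eqI:
  fixes w w' :: "nat \<Rightarrow> int"
  assumes "w \<in> PiE {..<n} A" "w' \<in> PiE {..<n} B" "\<And>i. i < n \<Longrightarrow> w i = w' i"
  shows "w = w'"
  using assms by (metis lessThan_iff extensionalityI PiE_iff)

lemma inj_on_balance_odd:
  assumes "odd n"
  shows "inj_on (balance n) (PiE {..<n} (\<lambda>_. UNIV))"
proof (rule inj_onI)
  fix w w' assume w: "w \<in> PiE {..<n} (\<lambda>_. UNIV)" "w' \<in> PiE {..<n} (\<lambda>_. UNIV)"
    and eq: "balance n w = balance n w'"
  have n: "0 < n" using assms by (rule odd_pos)
  have "\<not> (\<exists>i<n. w i \<noteq> w' i)"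
  proof
    assume "\<exists>i<n. w i \<noteq> w' i"
    from balance_collision(2)[OF n eq this] have "even n"
      by (intro even_if_alternating[OF n, of "\<lambda>i. w i < w' i"]) blast
    then show False using assms by simp
  qed
  then show "w = w'" using PiE_lessThan_eqI[OF w] by blast
qed

text \<open>For even \<open>n\<close> these are the vectors that can be moved by \<open>(-1, 1, -1, \<dots>)\<close> without leaving the
  nonpositive orthant, on which \<open>balance\<close> is linear and invariant under this move. Removing them leaves
  one representative in each fibre of \<open>balance\<close>.\<close>

definition alternating_slack :: "nat \<Rightarrow> (nat \<Rightarrow> int) set"
  where "alternating_slack n = PiE {..<n} (\<lambda>i. if even i then {..0} else {..-1})"

lemma alternating_slack_iff:
  "w \<in> alternating_slack n \<longleftrightarrow>
    w \<in> PiE {..<n} (\<lambda>_. UNIV) \<and> (\<forall>i<n. w i \<le> (if even i then 0 else - 1))"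
proof -
  have "(w i \<in> (if even i then {..0} else {..- 1})) = (w i \<le> (if even i then 0 else - 1))" for i
    by simp
  then show ?thesis by (simp add: alternating_slack_def PiE_iff) blast
qed

lemma inj_on_balance_even:
  assumes "0 < n"
  shows "inj_on (balance n) (PiE {..<n} (\<lambda>_. UNIV) - alternating_slack n)"
proof (rule inj_onI)
  fix w w'
  assume w: "w \<in> PiE {..<n} (\<lambda>_. UNIV) - alternating_slack n"
      "w' \<in> PiE {..<n} (\<lambda>_. UNIV) - alternating_slack n"
    and eq: "balance n w = balance n w'"
  have "\<not> (\<exists>i<n. w i \<noteq> w' i)"
  proof
    assume ne: "\<exists>i<n. w i \<noteq> w' i"
    note coll = balance_collision[OF assms eq ne]
    have sgn: "w i < w' i \<longleftrightarrow> (if even i then w 0 < w' 0 else \<not> w 0 < w' 0)" if "i < n" for i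
      using that
    proof (induction i)
      case (Suc i)
      then show ?case using coll(2)[of "Suc i"] by (auto simp: cyc_pred_def)
    qed simp
    show False
    proof (cases "w 0 < w' 0")
      case True
      have "w' i < w i" if "i < n" "odd i" for i using sgn[of i] that coll(1)[of i] True by auto
      then have "w' i \<le> -1" if "i < n" "odd i" for i using that coll(1)[of i] by fastforce
      then have "w' \<in> alternating_slack n"
        using w(2) coll(1) by (auto simp: alternating_slack_iff)
      then show False using w(2) by simp
    next
      case False
      have "w i < w' i" if "i < n" "odd i" for i using sgn[of i] that coll(1)[of i] False by auto
      then have "w i \<le> -1" if "i < n" "odd i" for i using that coll(1)[of i] by fastforce
      then have "w \<in> alternating_slack n"
        using w(1) coll(1) by (auto simp: alternating_slack_iff)
      then show False using w(1) by simp
    qed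
  qed
  then show "w = w'" using w PiE_lessThan_eqI[of w n "\<lambda>_. UNIV" w' "\<lambda>_. UNIV"] by blast
qed

section \<open>Greedy weights that close up around the cycle\<close>

text \<open>The greedy weights computed along the path of the vertices \<open>0, 1, \<dots>\<close> when the edge that precedes
  vertex \<open>0\<close> already has weight \<open>p\<close>: the edge that follows vertex \<open>i\<close> gets \<open>greedy v p (i + 1)\<close>. They
  close up to weights on the \<open>n\<close>-cycle iff \<open>greedy v p n = p\<close>.\<close>

fun greedy :: "(nat \<Rightarrow> int) \<Rightarrow> int \<Rightarrow> nat \<Rightarrow> int" where
  "greedy v p 0 = p"
| "greedy v p (Suc i) = max 0 (- v i - greedy v p i)"

lemma greedy_nonneg: "0 \<le> p \<Longrightarrow> 0 \<le> greedy v p i"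
  by (cases i) auto

lemma greedy_Suc_start:
  "greedy v (p + 1) i - greedy v p i \<in> (if even i then {0, 1} else {0, -1})"
proof (induction i)
  case (Suc i)
  then show ?case by (cases "even i") (auto simp: max_def)
qed simp

lemma greedy_merge:
  assumes "greedy v (p + 1) i = greedy v p i" "i \<le> j"
  shows "greedy v (p + 1) j = greedy v p j"
  using assms(2) by (induction rule: dec_induct) (simp_all add: assms(1))

text \<open>The return map \<open>p \<mapsto> greedy v p n\<close> on the natural numbers is bounded and, by
  \<open>greedy_Suc_start\<close>, changes by at most 1 from \<open>p\<close> to \<open>p + 1\<close>, upwards for even \<open>n\<close> and downwards for
  odd \<open>n\<close>. At the first place where it no longer exceeds the diagonal it has a fixed point, or
  \<open>n\<close> is odd and it crosses the diagonal halfway between two consecutive integers.\<close>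

lemma greedy_closing:
  assumes "0 < n"
  obtains p where "0 \<le> p" "greedy v p n = p"
  | p where "0 \<le> p" "odd n" "greedy v p n = p + 1" "greedy v (p + 1) n = p"
proof -
  let ?ret = "\<lambda>k. greedy v (int k) n"
  \<comment> \<open>The last greedy step bounds the return map by \<open>?M\<close>, so it is below the diagonal there.\<close>
  let ?M = "nat (- v (n - 1))"
  have "?ret ?M \<le> int ?M"
    using assms greedy_nonneg[of "int ?M" v "n - 1"] by (cases n) (auto simp: max_def)
  then have ex: "\<exists>k. ?ret k \<le> int k" by blast
  define k where "k = (LEAST k. ?ret k \<le> int k)"
  have k: "?ret k \<le> int k" unfolding k_def using ex by (rule LeastI_ex)
  show thesis
  proof (cases "?ret k = int k")
    case True then show thesis using that(1)[of "int k"] by simp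
  next
    case False
    have "k \<noteq> 0"
    proof
      assume "k = 0"
      then show False using False k greedy_nonneg[of 0 v n] by simp
    qed
    then obtain j where j: "k = Suc j" by (cases k) auto
    have "\<not> ?ret j \<le> int j" using not_less_Least[of j "\<lambda>k. ?ret k \<le> int k"] j k_def by auto
    moreover have "int k = int j + 1" using j by simp
    ultimately show thesis
      using False k greedy_Suc_start[of v "int j" n] that(2)[of "int j"] by (auto split: if_splits)
  qed
qed

lemma balance_preimage:
  assumes p: "0 \<le> p" "greedy v p n = p" and v: "v \<in> PiE {..<n} (\<lambda>_. UNIV)"
  shows "v \<in> balance n ` PiE {..<n} (\<lambda>_. UNIV)"
proof
  let ?w = "\<lambda>i\<in>{..<n}. v i + greedy v p i"
  show "?w \<in> PiE {..<n} (\<lambda>_. UNIV)" by auto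
  have deficit: "int (nat (- ?w (cyc_pred n i))) = greedy v p i" if "i < n" for i
  proof (cases i)
    case 0
    obtain m where m: "n = Suc m" using \<open>i < n\<close> by (cases n) auto
    have "int (nat (- (v m + greedy v p m))) = p" using p(2) unfolding m greedy.simps by linarith
    then show ?thesis by (simp add: 0 m cyc_pred_def)
  next
    case (Suc j)
    then show ?thesis using that by (simp add: cyc_pred_def)
  qed
  have "v i = balance n ?w i" if "i < n" for i
  proof -
    have "balance n ?w i = ?w i - int (nat (- ?w (cyc_pred n i)))"
      using that by (simp add: balance_def)
    also have "\<dots> = v i" unfolding deficit[OF that] using that by simp
    finally show ?thesis ..
  qed
  then show "v = balance n ?w" by (rule PiE_lessThan_eqI[OF v balance_in_PiE])
qed

text \<open>The vectors \<open>v\<close> whose consistent greedy weights are the half-integers \<open>\<gamma> i + 1/2\<close>.\<close>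

definition half_integral :: "nat \<Rightarrow> (nat \<Rightarrow> int) \<Rightarrow> nat \<Rightarrow> int"
  where "half_integral n \<gamma> = (\<lambda>i\<in>{..<n}. - (\<gamma> i + \<gamma> (cyc_pred n i) + 1))"

text \<open>The greedy runs from \<open>p\<close> and from \<open>p + 1\<close> swap their end values, so they differ by exactly 1 all the
  way, with alternating sign, and no weight is cut off at 0. The half-integer weights are the averages
  of the two runs, and \<open>\<gamma>\<close> is their minimum.\<close>

lemma half_integral_preimage:
  assumes p: "0 \<le> p" "odd n" "greedy v p n = p + 1" "greedy v (p + 1) n = p"
    and v: "v \<in> PiE {..<n} (\<lambda>_. UNIV)"
  shows "v \<in> half_integral n ` PiE {..<n} (\<lambda>_. {0..})"
proof
  let ?a = "greedy v (p + 1)" and ?b = "greedy v p"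
  let ?m = "\<lambda>i. min (?a i) (?b i)"
  let ?\<gamma> = "\<lambda>i\<in>{..<n}. ?m (Suc i)"
  show "?\<gamma> \<in> PiE {..<n} (\<lambda>_. {0..})"
    using greedy_nonneg[of p v] greedy_nonneg[of "p + 1" v] p(1) by (auto simp del: greedy.simps)
  have diff: "?a i - ?b i = (if even i then 1 else -1)" if "i \<le> n" for i
  proof -
    have "?a i \<noteq> ?b i" using greedy_merge[of v p i n] that p(3,4) by auto
    then show ?thesis using greedy_Suc_start[of v p i] by (auto split: if_splits)
  qed
  have step: "?m (Suc i) = - v i - 1 - ?m i" if "i < n" for i
    using diff[of i] diff[of "Suc i"] that by (cases "even i") (auto simp: max_def min_def split: if_splits)
  have pred: "?\<gamma> (cyc_pred n i) = ?m i" if "i < n" for i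
    using that p by (cases i) (auto simp: cyc_pred_def simp del: greedy.simps(2))
  have "v i = half_integral n ?\<gamma> i" if "i < n" for i
    using that step[OF that] pred[OF that] by (simp add: half_integral_def)
  moreover have "half_integral n ?\<gamma> \<in> PiE {..<n} (\<lambda>_. UNIV)"
    by (auto simp: half_integral_def)
  ultimately show "v = half_integral n ?\<gamma>" using PiE_lessThan_eqI[OF v] by blast
qed

text \<open>If both descriptions applied, the integer weights would lie alternately above and below the
  half-integer ones, which an odd cycle does not allow.\<close>

lemma half_integral_not_balance:
  assumes "odd n" "\<And>i. i < n \<Longrightarrow> 0 \<le> \<gamma> i"
  shows "half_integral n \<gamma> \<noteq> balance n w"
proof
  assume eq: "half_integral n \<gamma> = balance n w"
  have n: "0 < n" using assms(1) by (rule odd_pos)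
  have "even n"
  proof (rule even_if_alternating[OF n, of "\<lambda>i. \<gamma> i < int (nat (- w i))"])
    fix i assume i: "i < n"
    have "- (\<gamma> i + \<gamma> (cyc_pred n i) + 1) = w i - int (nat (- w (cyc_pred n i)))"
      using fun_cong[OF eq, of i] i by (simp add: balance_def half_integral_def)
    then show "(\<gamma> i < int (nat (- w i))) \<noteq> (\<gamma> (cyc_pred n i) < int (nat (- w (cyc_pred n i))))"
      using assms(2)[OF i] by linarith
  qed
  then show False using assms(1) by simp
qed

lemma inj_on_half_integral:
  assumes "odd n"
  shows "inj_on (half_integral n) (PiE {..<n} (\<lambda>_. {0..}))"
proof (rule inj_onI)
  fix \<gamma> \<gamma>' assume g: "\<gamma> \<in> PiE {..<n} (\<lambda>_. {0..})" "\<gamma>' \<in> PiE {..<n} (\<lambda>_. {0..})"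
    and eq: "half_integral n \<gamma> = half_integral n \<gamma>'"
  \<comment> \<open>\<open>half_integral n \<gamma>\<close> is \<open>balance n (- \<gamma>)\<close> lowered by 1 everywhere.\<close>
  let ?neg = "\<lambda>\<gamma>. \<lambda>i\<in>{..<n}. - \<gamma> i :: int"
  have "balance n (?neg \<gamma>) = balance n (?neg \<gamma>')"
  proof (rule PiE_lessThan_eqI[OF balance_in_PiE balance_in_PiE])
    fix i assume i: "i < n"
    have "0 \<le> \<gamma> (cyc_pred n i)" "0 \<le> \<gamma>' (cyc_pred n i)" using g cyc_pred_less[OF i] by auto
    then show "balance n (?neg \<gamma>) i = balance n (?neg \<gamma>') i"
      using fun_cong[OF eq, of i] i cyc_pred_less[OF i] by (simp add: balance_def half_integral_def)
  qed
  moreover have "?neg \<gamma> \<in> PiE {..<n} (\<lambda>_. UNIV)" "?neg \<gamma>' \<in> PiE {..<n} (\<lambda>_. UNIV)" by simp_all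
  ultimately have *: "?neg \<gamma> = ?neg \<gamma>'" by (rule inj_onD[OF inj_on_balance_odd[OF assms]])
  show "\<gamma> = \<gamma>'"
  proof (rule PiE_lessThan_eqI[OF g])
    fix i assume "i < n" then show "\<gamma> i = \<gamma>' i" using fun_cong[OF *, of i] by simp
  qed
qed

lemma sum_evens: "(\<Sum>i<2 * s + 1. if even i then 1 else 0 :: nat) = s + 1"
  by (induction s) auto

text \<open>Every vertex needs \<open>\<gamma> i + \<gamma> (i - 1) + 1\<close>, so twice the weight of a cover is at least
  \<open>2 \<Sum>\<gamma> + n\<close>. Rounding the half-integer weights \<open>\<gamma> i + 1/2\<close> up at the \<open>s + 1\<close> even places and
  down at the others gives a cover that reaches this bound up to parity; the only two adjacent even
  places are \<open>2 s\<close> and \<open>0\<close>.\<close>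

lemma min_degree_half_integral:
  assumes n: "n = 2 * s + 1" and \<gamma>: "\<And>i. i < n \<Longrightarrow> 0 \<le> \<gamma> i"
  shows "min_degree n (half_integral n \<gamma>) = (\<Sum>i<n. \<bar>\<gamma> i\<bar>) + int s + 2"
proof -
  let ?v = "half_integral n \<gamma>"
  let ?\<beta> = "\<lambda>i. nat (\<gamma> i) + (if even i then 1 else 0)"
  have sum_v: "(\<Sum>i<n. ?v i) = - (2 * (\<Sum>i<n. \<gamma> i)) - int n"
    using sum_cyc_pred[of \<gamma> n]
    by (simp add: half_integral_def sum_negf sum.distrib sum_subtractf)
  have "(\<Sum>i<n. int (nat (\<gamma> i))) = (\<Sum>i<n. \<gamma> i)" using \<gamma> by (intro sum.cong) auto
  moreover have "(\<Sum>i<n. ?\<beta> i) = (\<Sum>i<n. nat (\<gamma> i)) + (s + 1)"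
    using sum_evens[of s] by (simp only: sum.distrib n)
  ultimately have sum_\<beta>: "int (\<Sum>i<n. ?\<beta> i) = (\<Sum>i<n. \<gamma> i) + int s + 1" by simp
  have "cover_num n ?v = (\<Sum>i<n. ?\<beta> i)"
  proof (rule cover_num_eqI)
    show "covers n ?v ?\<beta>" unfolding covers_def
    proof (intro allI impI)
      fix i assume i: "i < n"
      have "even i \<or> even (cyc_pred n i)" by (cases i) (auto simp: cyc_pred_def)
      then show "0 \<le> ?v i + int (?\<beta> i) + int (?\<beta> (cyc_pred n i))"
        using i \<gamma>[OF i] \<gamma>[OF cyc_pred_less[OF i]] by (auto simp: half_integral_def)
    qed
  next
    fix \<beta> assume "covers n ?v \<beta>"
    then have "0 \<le> (\<Sum>i<n. ?v i + int (\<beta> i) + int (\<beta> (cyc_pred n i)))"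
      by (intro sum_nonneg) (auto simp: covers_def)
    also have "\<dots> = (\<Sum>i<n. ?v i) + 2 * int (\<Sum>i<n. \<beta> i)"
      using sum_cyc_pred[of "\<lambda>i. int (\<beta> i)" n] by (simp add: sum.distrib)
    finally show "(\<Sum>i<n. ?\<beta> i) \<le> (\<Sum>i<n. \<beta> i)"
      using sum_v sum_\<beta> n by linarith
  qed
  moreover have "(\<Sum>i<n. \<bar>\<gamma> i\<bar>) = (\<Sum>i<n. \<gamma> i)" using \<gamma> by (intro sum.cong) auto
  ultimately show ?thesis using sum_v sum_\<beta> n by (simp add: min_degree_def)
qed

text \<open>Among the preimages of \<open>v\<close>, one with the least deficit at the odd place \<open>n - 1\<close> has no alternating
  slack: otherwise the alternating move would lower this deficit.\<close>

lemma balance_surj_even: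
  assumes n: "0 < n" "even n" and v: "v \<in> PiE {..<n} (\<lambda>_. UNIV)"
  shows "v \<in> balance n ` (PiE {..<n} (\<lambda>_. UNIV) - alternating_slack n)"
proof -
  let ?pre = "\<lambda>w. w \<in> PiE {..<n} (\<lambda>_. UNIV) \<and> balance n w = v"
  have "\<exists>w. ?pre w"
  proof (rule greedy_closing[OF n(1), of v])
    fix p assume "0 \<le> p" "greedy v p n = p"
    from balance_preimage[OF this v] show ?thesis by blast
  qed (use n in auto)
  then obtain w\<^sub>0 where "?pre w\<^sub>0" ..
  from ex_has_least_nat[of ?pre, OF this, of "\<lambda>w. nat (- w (n - 1))"]
  obtain w where w: "?pre w"
    and least: "\<And>w'. ?pre w' \<Longrightarrow> nat (- w (n - 1)) \<le> nat (- w' (n - 1))"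
    by auto
  have "w \<notin> alternating_slack n"
  proof
    assume bad: "w \<in> alternating_slack n"
    have neg: "w i \<le> (if even i then 0 else -1)" if "i < n" for i
      using bad that unfolding alternating_slack_iff by blast
    let ?w = "\<lambda>i\<in>{..<n}. w i + (if even i then -1 else 1)"
    have "balance n ?w = v"
    proof (rule PiE_lessThan_eqI[OF balance_in_PiE v])
      fix i assume i: "i < n"
      have par: "even (cyc_pred n i) \<longleftrightarrow> odd i" using n by (cases i) (auto simp: cyc_pred_def)
      have "v i = w i - int (nat (- w (cyc_pred n i)))" 
        using fun_cong[OF conjunct2[OF w], of i] i by (simp add: balance_def)
      moreover have "balance n ?w i = ?w i - int (nat (- ?w (cyc_pred n i)))"
        using i by (simp add: balance_def)
      ultimately show "balance n ?w i = v i"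
        using i par neg[OF i] neg[OF cyc_pred_less[OF i]] cyc_pred_less[OF i]
        by (cases "even i") simp_all
    qed
    moreover have "?w \<in> PiE {..<n} (\<lambda>_. UNIV)" by simp
    ultimately have "nat (- w (n - 1)) \<le> nat (- ?w (n - 1))" by (intro least conjI)
    moreover have "?w (n - 1) = w (n - 1) + 1" using n by simp
    ultimately show False using neg[of "n - 1"] n by simp
  qed
  then show ?thesis using w by (intro image_eqI[of _ _ w]) simp_all
qed

section \<open>Counting monomials and their degrees\<close>

text \<open>The pair \<open>(v, b)\<close> encodes the monomial \<open>x\<^sup>m \<sigma>\<^sup>b\<close> with \<open>m i = v i + b\<close>, of degree \<open>d\<close>. The index set
  \<open>{..<n}\<close> is imposed by extensionality, so that distinct elements are distinct monomials.\<close>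

definition monomial_set :: "nat \<Rightarrow> nat \<Rightarrow> ((nat \<Rightarrow> int) \<times> nat) set"
  where "monomial_set n d = {(v, b). v \<in> PiE {..<n} (\<lambda>_. UNIV) \<and>
    (\<exists>\<beta>. covers n v \<beta> \<and> (\<Sum>i<n. \<beta> i) = b) \<and> (\<Sum>i<n. v i) + 3 * int b = int d}"

definition min_degree_set :: "nat \<Rightarrow> nat \<Rightarrow> (nat \<Rightarrow> int) set"
  where "min_degree_set n d = {v \<in> PiE {..<n} (\<lambda>_. UNIV). min_degree n v = int d}"

lemma finite_monomial_set: "finite (monomial_set n d)"
proof (rule finite_subset)
  show "finite (PiE {..<n} (\<lambda>_. {- 2 * int d..int d}) \<times> {..d})"
    by (intro finite_cartesian_product finite_PiE) simp_all
  show "monomial_set n d \<subseteq> PiE {..<n} (\<lambda>_. {- 2 * int d..int d}) \<times> {..d}"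
  proof (rule subrelI, rule SigmaI)
    fix v b assume "(v, b) \<in> monomial_set n d"
    then obtain \<beta> where v: "v \<in> PiE {..<n} (\<lambda>_. UNIV)" and \<beta>: "covers n v \<beta>" "(\<Sum>i<n. \<beta> i) = b"
      and d: "(\<Sum>i<n. v i) + 3 * int b = int d" by (auto simp: monomial_set_def)
    define \<alpha> where "\<alpha> i = v i + int (\<beta> i) + int (\<beta> (cyc_pred n i))" for i
    have \<alpha>: "0 \<le> \<alpha> i" if "i < n" for i using \<beta>(1) that by (simp add: covers_def \<alpha>_def)
    have "(\<Sum>i<n. \<alpha> i) = (\<Sum>i<n. v i) + 2 * int b"
      using sum_cyc_pred[of "\<lambda>i. int (\<beta> i)" n] \<beta>(2) by (simp add: \<alpha>_def sum.distrib flip: of_nat_sum)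
    then have total: "(\<Sum>i<n. \<alpha> i) + int b = int d" using d by simp
    have "0 \<le> (\<Sum>i<n. \<alpha> i)" using \<alpha> by (intro sum_nonneg) simp
    then have "b \<le> d" using total by linarith
    then show "b \<in> {..d}" by simp
    have "- 2 * int d \<le> v i \<and> v i \<le> int d" if i: "i < n" for i
    proof -
      have "\<alpha> i \<le> (\<Sum>i<n. \<alpha> i)" using \<alpha> i by (intro member_le_sum) auto
      moreover have "\<beta> j \<le> b" if "j < n" for j
        using member_le_sum[of j "{..<n}" \<beta>] that \<beta>(2) by simp
      from this[OF i] this[OF cyc_pred_less[OF i]] have "\<beta> i \<le> b" "\<beta> (cyc_pred n i) \<le> b" .
      ultimately show ?thesis using \<alpha>[OF i] total \<open>b \<le> d\<close> unfolding \<alpha>_def by linarith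
    qed
    then show "v \<in> PiE {..<n} (\<lambda>_. {- 2 * int d..int d})" using v by (auto simp: PiE_iff)
  qed
qed

text \<open>A monomial is divisible by \<open>P \<sigma>\<close> within the Rees algebra unless \<open>b\<close> is the cover number of \<open>v\<close>.\<close>

lemma monomial_set_decomposition:
  assumes "0 < n"
  shows "monomial_set n d = (\<lambda>(v, b). (v, Suc b)) ` (if 3 \<le> d then monomial_set n (d - 3) else {})
    \<union> (\<lambda>v. (v, cover_num n v)) ` min_degree_set n d" (is "?L = ?S \<union> ?T")
proof -
  have mem: "(v, b) \<in> monomial_set n d \<longleftrightarrow> v \<in> PiE {..<n} (\<lambda>_. UNIV) \<and> cover_num n v \<le> b \<and>
    (\<Sum>i<n. v i) + 3 * int b = int d" for v b d
    by (simp add: monomial_set_def cover_iff_ge_cover_num[OF assms])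
  have deg_nonneg: "0 \<le> (\<Sum>i<n. v i) + 3 * int (cover_num n v)" for v
  proof -
    obtain \<beta> where \<beta>: "covers n v \<beta>" "(\<Sum>i<n. \<beta> i) = cover_num n v" using cover_num_attained by blast
    have "0 \<le> (\<Sum>i<n. v i + int (\<beta> i) + int (\<beta> (cyc_pred n i)))"
      using \<beta>(1) by (intro sum_nonneg) (auto simp: covers_def)
    also have "\<dots> = (\<Sum>i<n. v i) + 2 * int (cover_num n v)"
      using sum_cyc_pred[of "\<lambda>i. int (\<beta> i)" n] \<beta>(2) by (simp add: sum.distrib flip: of_nat_sum)
    finally show ?thesis by linarith
  qed
  have "p \<in> ?L \<longleftrightarrow> p \<in> ?S \<union> ?T" for p
  proof (cases p)
    case (Pair v b)
    have S: "(v, b) \<in> ?S \<longleftrightarrow> 3 \<le> d \<and> 1 \<le> b \<and> (v, b - 1) \<in> monomial_set n (d - 3)"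
      by (cases b) (auto simp: image_iff split: prod.splits intro: bexI[of _ "(v, b - 1)"])
    have T: "(v, b) \<in> ?T \<longleftrightarrow> v \<in> PiE {..<n} (\<lambda>_. UNIV) \<and> b = cover_num n v \<and>
      (\<Sum>i<n. v i) + 3 * int b = int d"
      by (auto simp: min_degree_set_def min_degree_def)
    have arith: "c \<le> b \<and> S + 3 * int b = int d \<longleftrightarrow>
        3 \<le> d \<and> 1 \<le> b \<and> c \<le> b - 1 \<and> S + 3 * int (b - 1) = int (d - 3) \<or>
        b = c \<and> S + 3 * int b = int d" if "0 \<le> S + 3 * int c" for S c
      using that by presburger
    show ?thesis unfolding Pair Un_iff S T mem using arith[OF deg_nonneg[of v]] by blast
  qed
  then show ?thesis by blast
qed

lemma card_monomial_set:
  assumes "0 < n"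
  shows "card (monomial_set n d) =
    (if 3 \<le> d then card (monomial_set n (d - 3)) else 0) + card (min_degree_set n d)"
proof -
  let ?S = "(\<lambda>(v, b). (v, Suc b)) ` (if 3 \<le> d then monomial_set n (d - 3) else {})"
  let ?T = "(\<lambda>v. (v, cover_num n v)) ` min_degree_set n d"
  have "finite (?S \<union> ?T)"
    unfolding monomial_set_decomposition[OF assms, symmetric] by (rule finite_monomial_set)
  moreover have "?S \<inter> ?T = {}"
  proof -
    have False if "(v, b) \<in> monomial_set n (d - 3)" "cover_num n v = Suc b" for v b
      using that by (simp add: monomial_set_def cover_iff_ge_cover_num[OF assms])
    then show ?thesis by (fastforce split: if_splits)
  qed
  ultimately have "card (monomial_set n d) = card ?S + card ?T"
    unfolding monomial_set_decomposition[OF assms, of d] by (simp add: card_Un_disjoint)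
  also have "card ?S = (if 3 \<le> d then card (monomial_set n (d - 3)) else 0)"
    by (subst card_image) (auto simp: inj_on_def)
  also have "card ?T = card (min_degree_set n d)" by (rule card_image) (auto simp: inj_on_def)
  finally show ?thesis .
qed

definition size_set :: "nat \<Rightarrow> (nat \<Rightarrow> int set) \<Rightarrow> nat \<Rightarrow> (nat \<Rightarrow> int) set"
  where "size_set n A d = {w \<in> PiE {..<n} A. (\<Sum>i<n. nat \<bar>w i\<bar>) = d}"

lemma finite_size_set: "finite (size_set n A d)"
proof (rule finite_subset)
  show "finite (PiE {..<n} (\<lambda>_. {- int d..int d}))" by (intro finite_PiE) simp_all
  show "size_set n A d \<subseteq> PiE {..<n} (\<lambda>_. {- int d..int d})"
  proof
    fix w assume w: "w \<in> size_set n A d"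
    have "nat \<bar>w i\<bar> \<le> d" if "i < n" for i
      using member_le_sum[of i "{..<n}" "\<lambda>i. nat \<bar>w i\<bar>"] that w by (simp add: size_set_def)
    then have "w i \<in> {- int d..int d}" if "i < n" for i using that by fastforce
    then show "w \<in> PiE {..<n} (\<lambda>_. {- int d..int d})"
      using w by (simp add: size_set_def PiE_iff)
  qed
qed

lemma min_degree_balance_iff:
  "min_degree n (balance n w) = int d \<longleftrightarrow> (\<Sum>i<n. nat \<bar>w i\<bar>) = d"
proof -
  have "min_degree n (balance n w) = int (\<Sum>i<n. nat \<bar>w i\<bar>)" by (simp add: min_degree_balance)
  then show ?thesis by (simp only: of_nat_eq_iff)
qed

lemma card_min_degree_set_even:
  assumes n: "0 < n" "even n"
  shows "card (min_degree_set n d) + card (size_set n (\<lambda>i. if even i then {..0} else {..-1}) d)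
    = card (size_set n (\<lambda>_. UNIV) d)"
proof -
  let ?W = "size_set n (\<lambda>_. UNIV) d"
  let ?B = "size_set n (\<lambda>i. if even i then {..0} else {..-1}) d"
  have "alternating_slack n \<subseteq> PiE {..<n} (\<lambda>_. UNIV)"
    unfolding alternating_slack_def by (rule PiE_mono) simp
  then have B: "?B = ?W \<inter> alternating_slack n"
    unfolding size_set_def alternating_slack_def by blast
  have "balance n ` (?W - ?B) = min_degree_set n d"
  proof
    show "balance n ` (?W - ?B) \<subseteq> min_degree_set n d"
    proof (rule image_subsetI)
      fix w assume "w \<in> ?W - ?B"
      then show "balance n w \<in> min_degree_set n d"
        using balance_in_PiE[of n w] by (simp add: min_degree_set_def size_set_def min_degree_balance_iff)
    qed
    show "min_degree_set n d \<subseteq> balance n ` (?W - ?B)"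
    proof
      fix v assume v: "v \<in> min_degree_set n d"
      then obtain w where w: "v = balance n w" "w \<in> PiE {..<n} (\<lambda>_. UNIV) - alternating_slack n"
        using balance_surj_even[OF n, of v] unfolding min_degree_set_def by blast
      then have "w \<in> ?W - ?B" using v unfolding B
        by (simp add: min_degree_set_def size_set_def min_degree_balance_iff)
      then show "v \<in> balance n ` (?W - ?B)" using w(1) by blast
    qed
  qed
  moreover have "inj_on (balance n) (?W - ?B)"
    unfolding B by (rule inj_on_subset[OF inj_on_balance_even[OF n(1)]]) (auto simp: size_set_def)
  ultimately have "card (min_degree_set n d) = card (?W - ?B)" by (metis card_image)
  moreover have "?B \<subseteq> ?W" using B by blast
  ultimately show ?thesis
    using card_mono[OF finite_size_set \<open>?B \<subseteq> ?W\<close>] by (simp add: card_Diff_subset finite_size_set)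
qed

lemma card_min_degree_set_odd:
  assumes n: "n = 2 * s + 1"
  shows "card (min_degree_set n d) = card (size_set n (\<lambda>_. UNIV) d) +
    (if s + 2 \<le> d then card (size_set n (\<lambda>_. {0..}) (d - (s + 2))) else 0)"
proof -
  let ?W = "size_set n (\<lambda>_. UNIV) d"
  let ?H = "if s + 2 \<le> d then size_set n (\<lambda>_. {0..}) (d - (s + 2)) else {}"
  have odd: "odd n" "0 < n" using n by auto
  have H: "\<gamma> \<in> ?H \<longleftrightarrow> \<gamma> \<in> PiE {..<n} (\<lambda>_. {0..}) \<and> (\<Sum>i<n. nat \<bar>\<gamma> i\<bar>) + s + 2 = d" for \<gamma>
  proof -
    have "x + s + 2 = d \<longleftrightarrow> s + 2 \<le> d \<and> x = d - (s + 2)" for x :: nat by arith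
    then show ?thesis by (simp add: size_set_def)
  qed
  have deg: "min_degree n (half_integral n \<gamma>) = int ((\<Sum>i<n. nat \<bar>\<gamma> i\<bar>) + s + 2)"
    if "\<gamma> \<in> PiE {..<n} (\<lambda>_. {0..})" for \<gamma>
  proof -
    have "0 \<le> \<gamma> i" if "i < n" for i using \<open>\<gamma> \<in> _\<close> that by (simp add: PiE_iff)
    from min_degree_half_integral[OF n this] show ?thesis by simp
  qed
  have half_in: "half_integral n \<gamma> \<in> PiE {..<n} (\<lambda>_. UNIV)" for \<gamma>
    by (auto simp: half_integral_def)
  have "min_degree_set n d = balance n ` ?W \<union> half_integral n ` ?H"
  proof
    show "balance n ` ?W \<union> half_integral n ` ?H \<subseteq> min_degree_set n d"
    proof (intro Un_least image_subsetI)
      fix w assume "w \<in> ?W"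
      then show "balance n w \<in> min_degree_set n d"
        using balance_in_PiE[of n w] by (simp add: min_degree_set_def size_set_def min_degree_balance_iff)
    next
      fix \<gamma> assume "\<gamma> \<in> ?H"
      then show "half_integral n \<gamma> \<in> min_degree_set n d"
        using half_in deg unfolding H min_degree_set_def by blast
    qed
    show "min_degree_set n d \<subseteq> balance n ` ?W \<union> half_integral n ` ?H"
    proof
      fix v assume "v \<in> min_degree_set n d"
      then have v: "v \<in> PiE {..<n} (\<lambda>_. UNIV)" "min_degree n v = int d"
        by (simp_all add: min_degree_set_def)
      show "v \<in> balance n ` ?W \<union> half_integral n ` ?H"
      proof (rule greedy_closing[OF odd(2), of v])
        fix p assume "0 \<le> p" "greedy v p n = p"
        from balance_preimage[OF this v(1)] obtain w
          where w: "v = balance n w" "w \<in> PiE {..<n} (\<lambda>_. UNIV)" by blast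
        then have "w \<in> ?W" using v(2) by (simp add: size_set_def min_degree_balance_iff)
        then show ?thesis using w(1) by blast
      next
        fix p assume "0 \<le> p" "odd n" "greedy v p n = p + 1" "greedy v (p + 1) n = p"
        from half_integral_preimage[OF this v(1)] obtain \<gamma>
          where \<gamma>: "v = half_integral n \<gamma>" "\<gamma> \<in> PiE {..<n} (\<lambda>_. {0..})" by blast
        then have "\<gamma> \<in> ?H" unfolding H using v(2) deg[OF \<gamma>(2)] by (simp only: of_nat_eq_iff)
        then show ?thesis using \<gamma>(1) by blast
      qed
    qed
  qed
  moreover have "balance n ` ?W \<inter> half_integral n ` ?H = {}"
  proof -
    have "half_integral n \<gamma> \<noteq> balance n w" if "\<gamma> \<in> ?H" for \<gamma> w
    proof -
      have "\<gamma> \<in> PiE {..<n} (\<lambda>_. {0..})" using that unfolding H by blast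
      then have "0 \<le> \<gamma> i" if "i < n" for i using that by (simp add: PiE_iff)
      then show ?thesis by (rule half_integral_not_balance[OF odd(1)])
    qed
    then show ?thesis unfolding disjoint_iff by blast
  qed
  moreover have "finite ?H" by (simp add: finite_size_set)
  ultimately have "card (min_degree_set n d) = card (balance n ` ?W) + card (half_integral n ` ?H)"
    by (simp add: card_Un_disjoint finite_size_set)
  also have "card (balance n ` ?W) = card ?W"
    by (rule card_image, rule inj_on_subset[OF inj_on_balance_odd[OF odd(1)]]) (auto simp: size_set_def)
  also have "card (half_integral n ` ?H) = card ?H"
    by (rule card_image, rule inj_on_subset[OF inj_on_half_integral[OF odd(1)]]) (use H in blast)
  finally show ?thesis by simp
qed

section \<open>Generating functions\<close>

lemma size_set_Suc:
  "size_set (Suc n) A d =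
    (\<lambda>(x, w). w(n := x)) ` {p \<in> A n \<times> PiE {..<n} A. nat \<bar>fst p\<bar> + (\<Sum>i<n. nat \<bar>snd p i\<bar>) = d}"
proof -
  let ?ext = "\<lambda>(x, w). w(n := x)"
  have "(\<Sum>i<Suc n. nat \<bar>?ext p i\<bar>) = nat \<bar>fst p\<bar> + (\<Sum>i<n. nat \<bar>snd p i\<bar>)" for p :: "int \<times> (nat \<Rightarrow> int)"
    by (simp add: case_prod_unfold)
  moreover have "size_set (Suc n) A d =
      ?ext ` {p \<in> A n \<times> PiE {..<n} A. (\<Sum>i<Suc n. nat \<bar>?ext p i\<bar>) = d}"
    unfolding size_set_def lessThan_Suc PiE_insert_eq by blast
  ultimately show ?thesis by simp
qed

lemma gf_size_set:
  "Abs_fps (\<lambda>d. of_nat (card (size_set n A d)) :: rat) =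
    (\<Prod>i<n. Abs_fps (\<lambda>d. of_nat (card {x \<in> A i. nat \<bar>x\<bar> = d})))"
proof (induction n)
  case 0
  have "size_set 0 A d = (if d = 0 then {\<lambda>_. undefined} else {})" for d by (auto simp: size_set_def)
  then show ?case by (auto simp: fps_eq_iff)
next
  case (Suc n)
  let ?X = "\<lambda>k. {x \<in> A n. nat \<bar>x\<bar> = k}"
  have fin: "finite (?X k)" for k
    by (rule finite_subset[of _ "{- int k..int k}"]) auto
  have "card (size_set (Suc n) A d) = (\<Sum>k=0..d. card (?X k) * card (size_set n A (d - k)))" for d
  proof -
    have "size_set (Suc n) A d = (\<lambda>(x, w). w(n := x)) ` (\<Union>k\<in>{0..d}. ?X k \<times> size_set n A (d - k))"
    proof -
      have split: "a + b = d \<longleftrightarrow> a \<in> {0..d} \<and> b = d - a" for a b :: nat by auto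
      have "{p \<in> A n \<times> PiE {..<n} A. nat \<bar>fst p\<bar> + (\<Sum>i<n. nat \<bar>snd p i\<bar>) = d} =
          (\<Union>k\<in>{0..d}. ?X k \<times> size_set n A (d - k))" (is "?L = ?R")
      proof (rule set_eqI)
        fix p show "p \<in> ?L \<longleftrightarrow> p \<in> ?R"
          unfolding split size_set_def by (cases p) (simp, blast)
      qed
      then show ?thesis unfolding size_set_Suc by (rule arg_cong)
    qed
    moreover have "inj_on (\<lambda>(x, w). w(n := x)) (\<Union>k\<in>{0..d}. ?X k \<times> size_set n A (d - k))"
    proof (rule inj_on_subset[OF inj_combinator[of n "{..<n}" A]])
      show "(\<Union>k\<in>{0..d}. ?X k \<times> size_set n A (d - k)) \<subseteq> A n \<times> PiE {..<n} A"
        unfolding size_set_def by blast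
    qed simp
    ultimately have "card (size_set (Suc n) A d) = card (\<Union>k\<in>{0..d}. ?X k \<times> size_set n A (d - k))"
      by (simp add: card_image)
    also have "\<dots> = (\<Sum>k=0..d. card (?X k \<times> size_set n A (d - k)))"
      by (rule card_UN_disjoint) (auto simp: fin finite_size_set)
    finally show ?thesis by (simp add: card_cartesian_product)
  qed
  then have "Abs_fps (\<lambda>d. of_nat (card (size_set (Suc n) A d)) :: rat) =
    Abs_fps (\<lambda>d. of_nat (card (?X d))) * Abs_fps (\<lambda>d. of_nat (card (size_set n A d)))"
    by (simp add: fps_eq_iff fps_mult_nth)
  then show ?case by (simp add: Suc.IH mult.commute)
qed

lemma gf_int: "Abs_fps (\<lambda>d. of_nat (card {x::int. nat \<bar>x\<bar> = d}) :: rat) * (1 - fps_X) = 1 + fps_X"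
proof -
  have "{x::int. nat \<bar>x\<bar> = d} = {int d, - int d}" for d by auto
  then have "card {x::int. nat \<bar>x\<bar> = d} = (if d = 0 then 1 else 2)" for d by simp
  then show ?thesis
    by (auto simp: fps_eq_iff right_diff_distrib fps_X_mult_right_nth)
qed

lemma gf_nonneg: "Abs_fps (\<lambda>d. of_nat (card {x\<in>{0::int..}. nat \<bar>x\<bar> = d}) :: rat) * (1 - fps_X) = 1"
proof -
  have "{x\<in>{0::int..}. nat \<bar>x\<bar> = d} = {int d}" for d by auto
  then show ?thesis by (auto simp: fps_eq_iff right_diff_distrib fps_X_mult_right_nth)
qed

lemma gf_nonpos: "Abs_fps (\<lambda>d. of_nat (card {x\<in>{..0::int}. nat \<bar>x\<bar> = d}) :: rat) * (1 - fps_X) = 1"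
proof -
  have "{x\<in>{..0::int}. nat \<bar>x\<bar> = d} = {- int d}" for d by auto
  then show ?thesis by (auto simp: fps_eq_iff right_diff_distrib fps_X_mult_right_nth)
qed

lemma gf_neg: "Abs_fps (\<lambda>d. of_nat (card {x\<in>{..-1::int}. nat \<bar>x\<bar> = d}) :: rat) * (1 - fps_X) = fps_X"
proof -
  have "{x\<in>{..-1::int}. nat \<bar>x\<bar> = d} = (if d = 0 then {} else {- int d})" for d by auto
  then have "card {x\<in>{..-1::int}. nat \<bar>x\<bar> = d} = (if d = 0 then 0 else 1)" for d by simp
  then show ?thesis by (auto simp: fps_eq_iff right_diff_distrib fps_X_mult_right_nth)
qed

lemma prod_alternating: "(\<Prod>i<2 * s. if even i then a else b) = (a * b) ^ s" for a b :: "'a::comm_monoid_mult"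
  by (induction s) (auto simp: mult_ac)

lemma fps_shift_if:
  "fps_X ^ k * Abs_fps f = Abs_fps (\<lambda>d. if k \<le> d then f (d - k) else 0 :: rat)"
  by (auto simp: fps_eq_iff fps_X_power_mult_nth)

text \<open>Multiplication by \<open>P \<sigma>\<close> shifts the degree by 3.\<close>

lemma gf_monomial_set_mult:
  assumes "0 < n"
  shows "Abs_fps (\<lambda>d. of_nat (card (monomial_set n d)) :: rat) * (1 - fps_X ^ 3) =
    Abs_fps (\<lambda>d. of_nat (card (min_degree_set n d)))"
proof -
  let ?f = "\<lambda>d. of_nat (card (monomial_set n d)) :: rat"
  have "Abs_fps ?f = fps_X ^ 3 * Abs_fps ?f + Abs_fps (\<lambda>d. of_nat (card (min_degree_set n d)))"
    unfolding fps_shift_if by (rule fps_ext) (simp add: card_monomial_set[OF assms, of _])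
  then show ?thesis by (simp add: algebra_simps)
qed

lemma gf_monomial_set_even:
  assumes n: "n = 2 * s" "0 < n"
  shows "Abs_fps (\<lambda>d. of_nat (card (monomial_set n d)) :: rat) * (1 - fps_X ^ 3) * (1 - fps_X) ^ n =
    (1 + fps_X) ^ n - fps_X ^ s"
proof -
  let ?B = "\<lambda>i::nat. if even i then {..0} else {..-1::int}"
  let ?gf = "\<lambda>A. Abs_fps (\<lambda>d. of_nat (card (size_set n A d)) :: rat)"
  let ?one = "\<lambda>A. Abs_fps (\<lambda>d. of_nat (card {x \<in> A. nat \<bar>x\<bar> = d}) :: rat)"
  have even: "even n" using n by simp
  have "of_nat (card (min_degree_set n d)) = of_nat (card (size_set n (\<lambda>_. UNIV) d)) - (of_nat (card (size_set n ?B d)) :: rat)" for d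
    using card_min_degree_set_even[OF n(2) even, of d] by (simp flip: of_nat_add)
  then have split: "Abs_fps (\<lambda>d. of_nat (card (min_degree_set n d)) :: rat) = ?gf (\<lambda>_. UNIV) - ?gf ?B"
    by (simp add: fps_eq_iff)
  have W: "?gf (\<lambda>_. UNIV) * (1 - fps_X) ^ n = (1 + fps_X) ^ n"
    using gf_int by (simp add: gf_size_set power_mult_distrib[symmetric])
  have "?gf ?B = (\<Prod>i<2 * s. if even i then ?one {..0} else ?one {..-1})"
    unfolding gf_size_set n(1) by (rule prod.cong) (auto simp del: mem_Collect_eq)
  also have "\<dots> = (?one {..0} * ?one {..-1}) ^ s" by (rule prod_alternating)
  finally have "?gf ?B * (1 - fps_X) ^ n = ((?one {..0} * (1 - fps_X)) * (?one {..-1} * (1 - fps_X))) ^ s"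
    by (simp add: n(1) power_mult power_mult_distrib power2_eq_square mult_ac)
  also have "\<dots> = fps_X ^ s" unfolding gf_nonpos gf_neg by simp
  finally have B: "?gf ?B * (1 - fps_X) ^ n = fps_X ^ s" .
  show ?thesis unfolding gf_monomial_set_mult[OF n(2)] split left_diff_distrib W B ..
qed

lemma gf_monomial_set_odd:
  assumes n: "n = 2 * s + 1"
  shows "Abs_fps (\<lambda>d. of_nat (card (monomial_set n d)) :: rat) * (1 - fps_X ^ 3) * (1 - fps_X) ^ n =
    (1 + fps_X) ^ n + fps_X ^ (s + 2)"
proof -
  let ?gf = "\<lambda>A. Abs_fps (\<lambda>d. of_nat (card (size_set n (\<lambda>_. A) d)) :: rat)"
  have pos: "0 < n" using n by simp
  have split: "Abs_fps (\<lambda>d. of_nat (card (min_degree_set n d)) :: rat) = ?gf UNIV + fps_X ^ (s + 2) * ?gf {0..}"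
    unfolding fps_shift_if by (simp add: fps_eq_iff card_min_degree_set_odd[OF n])
  have W: "?gf UNIV * (1 - fps_X) ^ n = (1 + fps_X) ^ n"
    using gf_int by (simp add: gf_size_set power_mult_distrib[symmetric])
  have H: "?gf {0..} * (1 - fps_X) ^ n = 1"
    unfolding gf_size_set prod_constant card_lessThan power_mult_distrib[symmetric] gf_nonneg by simp
  show ?thesis unfolding gf_monomial_set_mult[OF pos] split distrib_right W mult.assoc H by simp
qed

text \<open>The geometric sum \<open>\<Sum> a\<^sup>k b\<^sup>s\<^sup>-\<^sup>1\<^sup>-\<^sup>k = (a\<^sup>s - b\<^sup>s) / (a - b)\<close> for \<open>a = (1 + z)\<^sup>2\<close> and \<open>b = z\<close>.\<close>

lemma hilbert_numerator:
  fixes z :: "'a::idom"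
  shows "(\<Sum>k=0..<s. (1 + z) ^ (2 * k) * z ^ (s - 1 - k)) * (1 + z + z ^ 2) = (1 + z) ^ (2 * s) - z ^ s"
proof (induction s)
  case (Suc s)
  have "(\<Sum>k=0..<s. (1 + z) ^ (2 * k) * z ^ (Suc s - 1 - k)) = z * (\<Sum>k=0..<s. (1 + z) ^ (2 * k) * z ^ (s - 1 - k))"
    unfolding sum_distrib_left
  proof (rule sum.cong[OF refl])
    fix k assume "k \<in> {0..<s}"
    then have "Suc s - 1 - k = Suc (s - 1 - k)" by auto
    then show "(1 + z) ^ (2 * k) * z ^ (Suc s - 1 - k) = z * ((1 + z) ^ (2 * k) * z ^ (s - 1 - k))" by simp
  qed
  then have "(\<Sum>k=0..<Suc s. (1 + z) ^ (2 * k) * z ^ (Suc s - 1 - k)) * (1 + z + z ^ 2)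
    = z * ((1 + z) ^ (2 * s) - z ^ s) + (1 + z) ^ (2 * s) * (1 + z + z ^ 2)"
    unfolding Suc.IH[symmetric] by (simp add: distrib_right mult.assoc)
  also have "\<dots> = (1 + z) ^ (2 * Suc s) - z ^ Suc s"
    by (simp add: algebra_simps power2_eq_square)
  finally show ?case .
qed simp

lemma fps_eq_quotientI:
  fixes f g :: "rat fps"
  assumes "f * (1 - fps_X ^ 3) * (1 - fps_X) ^ n = h" "g * (1 + fps_X + fps_X ^ 2) = h"
  shows "f = g / (1 - fps_X) ^ Suc n"
proof -
  have "(1 - fps_X ^ 3 :: rat fps) = (1 - fps_X) * (1 + fps_X + fps_X ^ 2)"
    by (simp add: algebra_simps power2_eq_square power3_eq_cube)
  then have "f * (1 - fps_X) ^ Suc n * (1 + fps_X + fps_X ^ 2) = g * (1 + fps_X + fps_X ^ 2)"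
    using assms by (simp add: mult_ac)
  moreover have "fps_nth (1 + fps_X + fps_X ^ 2 :: rat fps) 0 = 1" by simp
  then have "(1 + fps_X + fps_X ^ 2 :: rat fps) \<noteq> 0" by fastforce
  ultimately have "g = f * (1 - fps_X) ^ Suc n" by simp
  moreover have "fps_nth (1 - fps_X :: rat fps) 0 = 1" by simp
  then have "(1 - fps_X :: rat fps) \<noteq> 0" by fastforce
  ultimately show ?thesis by simp
qed

section \<open>The monomial basis of the Rees algebra\<close>

abbreviation monomial :: "(nat \<Rightarrow>\<^sub>0 nat) \<Rightarrow> nat \<Rightarrow> 'k::field mpol poly"
  where "monomial m b \<equiv> monom (Poly_Mapping.single m 1) b"

definition path_exp :: "nat \<Rightarrow> nat \<Rightarrow> nat \<Rightarrow>\<^sub>0 nat"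
  where "path_exp n j = (\<Sum>k<n - 2. Poly_Mapping.single ((j + k) mod n) 1)"

lemma gen_u_eq_monomial: "gen_u n j = monomial (path_exp n j) 1"
  by (simp add: gen_u_def path_mon_eq path_exp_def monom_Suc monom_0)

lemma prod_monomial:
  "finite A \<Longrightarrow> (\<Prod>i\<in>A. monomial (m i) (e i)) = monomial (\<Sum>i\<in>A. m i) (\<Sum>i\<in>A. e i)"
  by (induction A rule: finite_induct) (simp_all add: mult_monom mult_single one_pCons monom_0)

lemma monomial_power: "monomial m e ^ k = monomial (\<Sum>_<k. m) (k * e)"
  using prod_monomial[of "{..<k}" "\<lambda>_. m" "\<lambda>_. e"] by simp

lemma gprod_eq_monomial:
  "gprod n \<alpha> \<beta> = monomial
    ((\<Sum>i<n. Poly_Mapping.single i (\<alpha> i)) + (\<Sum>j<n. \<Sum>_<\<beta> j. path_exp n j)) (\<Sum>j<n. \<beta> j)"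
proof -
  have x: "gen_x i ^ a = (monomial (Poly_Mapping.single i a) 0 :: 'a mpol poly)" for i a
    by (simp add: gen_x_def const_poly_power var_power monom_0)
  show ?thesis
    unfolding x gen_u_eq_monomial monomial_power by (simp add: prod_monomial mult_monom mult_single)
qed

lemma lookup_sum_single:
  fixes n :: nat
  shows "Poly_Mapping.lookup (\<Sum>i<n. Poly_Mapping.single i (f i)) k = (if k < n then f k else 0 :: nat)"
  by (simp add: lookup_sum lookup_single when_def)

lemma mod_less_double: "a < 2 * n \<Longrightarrow> a mod n = (if a < n then a else a - n)" for n :: nat
  by (simp add: mod_if)

text \<open>The path that starts at \<open>j\<close> runs through the whole cycle except for its last two vertices
  \<open>j + n - 2\<close> and \<open>j + n - 1\<close>, that is, \<open>j - 2\<close> and \<open>j - 1\<close>.\<close>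

lemma lookup_path_exp:
  assumes n: "2 \<le> n" and jk: "j < n" "k < n"
  shows "Poly_Mapping.lookup (path_exp n j) k +
    (if j = (k + 2) mod n then 1 else 0) + (if j = (k + 1) mod n then 1 else 0) = 1"
proof -
  let ?hit = "\<lambda>t. if (j + t) mod n = k then 1 else 0 :: nat"
  have lookup: "Poly_Mapping.lookup (path_exp n j) k = (\<Sum>t<n - 2. ?hit t)"
    by (simp add: path_exp_def lookup_sum lookup_single when_def del: One_nat_def)
  have solve: "(j + t) mod n = k \<longleftrightarrow> t = (if j \<le> k then k - j else k + n - j)" if "t < n" for t
    using that jk by (auto simp: mod_less_double)
  have "(\<Sum>t<n. ?hit t) = (\<Sum>t<n. if t = (if j \<le> k then k - j else k + n - j) then 1 else 0)"
    using solve by (intro sum.cong) auto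
  also have "\<dots> = 1" using jk by auto
  finally have "(\<Sum>t<n. ?hit t) = 1" .
  moreover obtain m where "n = Suc (Suc m)" using n by (metis add_2_eq_Suc le_Suc_ex)
  then have "(\<Sum>t<n. ?hit t) = (\<Sum>t<n - 2. ?hit t) + ?hit (n - 2) + ?hit (n - 1)"
    by (simp del: One_nat_def)
  moreover have "(j + (n - 2)) mod n = k \<longleftrightarrow> j = (k + 2) mod n"
    using n jk by (auto simp: mod_less_double split: if_splits)
  moreover have "(j + (n - 1)) mod n = k \<longleftrightarrow> j = (k + 1) mod n"
    using n jk by (auto simp: mod_less_double split: if_splits)
  ultimately show ?thesis unfolding lookup by simp
qed

lemma lookup_path_exp_outside:
  "0 < n \<Longrightarrow> n \<le> k \<Longrightarrow> Poly_Mapping.lookup (path_exp n j) k = 0"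
  by (auto simp: path_exp_def lookup_sum lookup_single when_def) (metis mod_less_divisor not_le)

text \<open>On \<open>monomial_set n d\<close> all the numbers \<open>v i + int b\<close> are nonnegative, so \<open>nat\<close> loses nothing there.\<close>

definition normalized_monomial :: "nat \<Rightarrow> (nat \<Rightarrow> int) \<Rightarrow> nat \<Rightarrow> 'k::field mpol poly"
  where "normalized_monomial n v b = monomial (\<Sum>i<n. Poly_Mapping.single i (nat (v i + int b))) b"

lemma normalized_monomial_cong:
  "(\<And>i. i < n \<Longrightarrow> v i = v' i) \<Longrightarrow> normalized_monomial n v b = normalized_monomial n v' b"
  unfolding normalized_monomial_def by simp

text \<open>Each \<open>u\<^sub>j \<sigma>\<close> contributes 1 to \<open>b\<close> and to every exponent except the two at \<open>j - 2\<close> and \<open>j - 1\<close>. So the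
  exponent of \<open>x\<^sub>k\<close> minus \<open>b\<close> is the exponent \<open>\<alpha> k\<close> lowered by the multiplicities of \<open>u\<^sub>k\<^sub>+\<^sub>2\<close> and \<open>u\<^sub>k\<^sub>+\<^sub>1\<close>.\<close>

lemma gprod_eq_normalized_monomial:
  assumes n: "2 \<le> n"
  shows "gprod n \<alpha> \<beta> = normalized_monomial n
    (\<lambda>i. int (\<alpha> i) - int (\<beta> ((i + 2) mod n)) - int (\<beta> ((i + 1) mod n))) (\<Sum>j<n. \<beta> j)"
  unfolding gprod_eq_monomial normalized_monomial_def
proof (rule arg_cong[where f = "\<lambda>m. monomial m _"], rule poly_mapping_eqI)
  fix k
  let ?v = "\<lambda>i. int (\<alpha> i) - int (\<beta> ((i + 2) mod n)) - int (\<beta> ((i + 1) mod n))"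
  let ?e = "\<lambda>j. Poly_Mapping.lookup (path_exp n j) k"
  have lookup: "Poly_Mapping.lookup ((\<Sum>i<n. Poly_Mapping.single i (\<alpha> i)) + (\<Sum>j<n. \<Sum>_<\<beta> j. path_exp n j)) k
      = (if k < n then \<alpha> k else 0) + (\<Sum>j<n. \<beta> j * ?e j)"
  proof -
    have "Poly_Mapping.lookup (\<Sum>_<m. p) k = m * Poly_Mapping.lookup p k" for m :: nat and p :: "nat \<Rightarrow>\<^sub>0 nat"
      unfolding lookup_sum by simp
    then show ?thesis
      unfolding lookup_add lookup_sum_single by (simp add: lookup_sum del: sum_constant)
  qed
  show "Poly_Mapping.lookup ((\<Sum>i<n. Poly_Mapping.single i (\<alpha> i)) + (\<Sum>j<n. \<Sum>_<\<beta> j. path_exp n j)) k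
    = Poly_Mapping.lookup (\<Sum>i<n. Poly_Mapping.single i (nat (?v i + int (\<Sum>j<n. \<beta> j)))) k"
  proof (cases "k < n")
    case True
    have "(\<Sum>j<n. \<beta> j) = (\<Sum>j<n. \<beta> j * (?e j + (if j = (k + 2) mod n then 1 else 0)
        + (if j = (k + 1) mod n then 1 else 0)))"
      using lookup_path_exp[OF n _ True] by (intro sum.cong) auto
    also have "\<dots> = (\<Sum>j<n. \<beta> j * ?e j + (if j = (k + 2) mod n then \<beta> j else 0)
        + (if j = (k + 1) mod n then \<beta> j else 0))"
      by (intro sum.cong) (auto simp: algebra_simps)
    also have "\<dots> = (\<Sum>j<n. \<beta> j * ?e j) + \<beta> ((k + 2) mod n) + \<beta> ((k + 1) mod n)"
      using True by (simp add: sum.distrib)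
    finally show ?thesis unfolding lookup lookup_sum_single using True by (simp del: of_nat_sum)
  next
    case False
    then show ?thesis using n unfolding lookup lookup_sum_single by (simp add: lookup_path_exp_outside)
  qed
qed

lemma add_mod_cyc_pred:
  assumes "2 \<le> n" "i < n"
  shows "(cyc_pred n i + 2) mod n = (i + 1) mod n"
  using assms by (cases i) (auto simp: cyc_pred_def mod_less_double)

lemma sum_rotate:
  fixes f :: "nat \<Rightarrow> 'a::comm_monoid_add"
  assumes "c \<le> n"
  shows "(\<Sum>i<n. f ((i + c) mod n)) = (\<Sum>i<n. f i)"
proof (rule sum.reindex_bij_witness)
  fix i assume i: "i \<in> {..<n}"
  have "((i + c) mod n + (n - c)) mod n = (i + n) mod n" "((i + (n - c)) mod n + c) mod n = (i + n) mod n"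
    unfolding mod_add_left_eq using assms by simp_all
  then show "((i + c) mod n + (n - c)) mod n = i" "((i + (n - c)) mod n + c) mod n = i"
    using i by simp_all
qed auto

text \<open>The edge weights are the multiplicities of the generators, rotated by two places: the edge that
  follows vertex \<open>i\<close> carries the multiplicity of \<open>u\<^sub>i\<^sub>+\<^sub>2\<close>. The \<open>\<alpha> i\<close> are the surpluses of the cover.\<close>

lemma gprods_eq_normalized_monomials:
  assumes n: "2 \<le> n"
  shows "{gprod n \<alpha> \<beta> :: 'k::field mpol poly |\<alpha> \<beta>. (\<Sum>i<n. \<alpha> i) + (\<Sum>j<n. \<beta> j) = d} =
    (\<lambda>(v, b). normalized_monomial n v b) ` monomial_set n d" (is "?L = ?R")
proof
  have total: "(\<Sum>i<n. int (\<gamma> i) + int (\<gamma> (cyc_pred n i))) = 2 * int (\<Sum>i<n. \<gamma> i)" for \<gamma> :: "nat \<Rightarrow> nat"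
    using sum_cyc_pred[of "\<lambda>i. int (\<gamma> i)" n] by (simp add: sum.distrib)
  show "?L \<subseteq> ?R"
  proof (rule subsetI)
    fix f assume "f \<in> ?L"
    then obtain \<alpha> \<beta> where f: "f = gprod n \<alpha> \<beta>" and d: "(\<Sum>i<n. \<alpha> i) + (\<Sum>j<n. \<beta> j) = d"
      by blast
    define \<gamma> where "\<gamma> i = \<beta> ((i + 2) mod n)" for i
    define v where "v = (\<lambda>i\<in>{..<n}. int (\<alpha> i) - (int (\<gamma> i) + int (\<gamma> (cyc_pred n i))))"
    have sum_\<gamma>: "(\<Sum>i<n. \<gamma> i) = (\<Sum>j<n. \<beta> j)" unfolding \<gamma>_def by (rule sum_rotate[OF n])
    have "f = normalized_monomial n v (\<Sum>j<n. \<beta> j)"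
      unfolding f gprod_eq_normalized_monomial[OF n]
    proof (rule normalized_monomial_cong)
      fix i assume i: "i < n"
      have "\<gamma> (cyc_pred n i) = \<beta> ((i + 1) mod n)" unfolding \<gamma>_def add_mod_cyc_pred[OF n i] ..
      then show "int (\<alpha> i) - int (\<beta> ((i + 2) mod n)) - int (\<beta> ((i + 1) mod n)) = v i"
        using i by (simp add: v_def \<gamma>_def)
    qed
    moreover have "(v, (\<Sum>j<n. \<beta> j)) \<in> monomial_set n d"
    proof -
      have "v \<in> PiE {..<n} (\<lambda>_. UNIV)" by (simp add: v_def)
      moreover have "covers n v \<gamma>" by (simp add: covers_def v_def)
      moreover have "(\<Sum>i<n. v i) + 3 * int (\<Sum>j<n. \<beta> j) = int d"
        using total[of \<gamma>] by (simp add: v_def sum_subtractf sum_\<gamma> d[symmetric])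
      ultimately show ?thesis using sum_\<gamma> unfolding monomial_set_def by blast
    qed
    ultimately show "f \<in> ?R" by (intro image_eqI[of _ _ "(v, \<Sum>j<n. \<beta> j)"]) simp_all
  qed
  show "?R \<subseteq> ?L"
  proof (rule image_subsetI)
    fix p assume "p \<in> monomial_set n d"
    moreover obtain v b where p: "p = (v, b)" by (cases p)
    ultimately obtain \<gamma> where v: "v \<in> PiE {..<n} (\<lambda>_. UNIV)" and \<gamma>: "covers n v \<gamma>" "(\<Sum>i<n. \<gamma> i) = b"
      and d: "(\<Sum>i<n. v i) + 3 * int b = int d" unfolding monomial_set_def by blast
    define \<alpha> where "\<alpha> i = nat (v i + int (\<gamma> i) + int (\<gamma> (cyc_pred n i)))" for i
    define \<beta> where "\<beta> j = \<gamma> ((j + (n - 2)) mod n)" for j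
    have \<alpha>: "int (\<alpha> i) = v i + (int (\<gamma> i) + int (\<gamma> (cyc_pred n i)))" if "i < n" for i
      using \<gamma>(1) that by (simp add: covers_def \<alpha>_def)
    have \<beta>2: "\<beta> ((i + 2) mod n) = \<gamma> i" if "i < n" for i
    proof -
      have "((i + 2) mod n + (n - 2)) mod n = (i + n) mod n"
      proof -
        have "i + 2 + (n - 2) = i + n" using n by simp
        then show ?thesis by (simp only: mod_add_left_eq mod_add_self2)
      qed
      then show ?thesis using that by (simp add: \<beta>_def)
    qed
    have \<beta>1: "\<beta> ((i + 1) mod n) = \<gamma> (cyc_pred n i)" if "i < n" for i
      using \<beta>2[OF cyc_pred_less[OF that]] add_mod_cyc_pred[OF n that] by simp
    have sum_\<beta>: "(\<Sum>j<n. \<beta> j) = b" unfolding \<beta>_def using \<gamma>(2) sum_rotate[of "n - 2" n \<gamma>] by simp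
    have "int (\<Sum>i<n. \<alpha> i) = (\<Sum>i<n. v i) + 2 * int b"
      using \<alpha> total[of \<gamma>] \<gamma>(2) by (simp add: sum.distrib)
    then have "(\<Sum>i<n. \<alpha> i) + (\<Sum>j<n. \<beta> j) = d" using d sum_\<beta> by linarith
    moreover have "normalized_monomial n v b = (gprod n \<alpha> \<beta> :: 'k mpol poly)"
      unfolding gprod_eq_normalized_monomial[OF n] sum_\<beta>
    proof (rule normalized_monomial_cong)
      fix i assume i: "i < n"
      show "v i = int (\<alpha> i) - int (\<beta> ((i + 2) mod n)) - int (\<beta> ((i + 1) mod n))"
        unfolding \<beta>1[OF i] \<beta>2[OF i] \<alpha>[OF i] by simp
    qed
    ultimately show "(\<lambda>(v, b). normalized_monomial n v b) p \<in> ?L" unfolding p prod.case by blast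
  qed
qed

lemma monomial_eq_iff:
  "(monomial m b :: 'k::field mpol poly) = monomial m' b' \<longleftrightarrow> m = m' \<and> b = b'"
proof
  assume eq: "(monomial m b :: 'k mpol poly) = monomial m' b'"
  have nz: "Poly_Mapping.single m 1 \<noteq> (0 :: 'k mpol)" for m
    by (metis lookup_single_eq lookup_zero zero_neq_one)
  have "b = b'" using arg_cong[OF eq, of degree] by (simp add: degree_monom_eq nz)
  then have "Poly_Mapping.single m 1 = (Poly_Mapping.single m' 1 :: 'k mpol)"
    using arg_cong[OF eq, of "\<lambda>p. coeff p b"] by simp
  then have "Poly_Mapping.keys (Poly_Mapping.single m (1::'k)) = Poly_Mapping.keys (Poly_Mapping.single m' (1::'k))"
    by simp
  then show "m = m' \<and> b = b'" using \<open>b = b'\<close> by simp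
qed simp

lemma independent_monomials: "rees.independent (range (\<lambda>(m, b). monomial m b :: 'k::field mpol poly))"
proof
  assume "rees.dependent (range (\<lambda>(m, b). monomial m b :: 'k mpol poly))"
  then obtain t u f where t: "finite t" "t \<subseteq> range (\<lambda>(m, b). monomial m b :: 'k mpol poly)"
    and zero: "(\<Sum>g\<in>t. scaleK (u g) g) = 0" and f: "f \<in> t" "u f \<noteq> 0"
    unfolding rees.dependent_explicit by blast
  obtain m b where mb: "f = monomial m b" using t(2) f(1) by auto
  have "Poly_Mapping.lookup (coeff (scaleK (u g) g) b) m = (if g = f then u f else 0)" if g_in: "g \<in> t" for g
  proof -
    obtain m' b' where g: "g = monomial m' b'" using t(2) g_in by auto
    show ?thesis unfolding g mb monomial_eq_iff
      by (auto simp: scaleK_def smult_monom mult_single lookup_single)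
  qed
  then have "Poly_Mapping.lookup (coeff (\<Sum>g\<in>t. scaleK (u g) g) b) m = u f"
    using t(1) f(1) by (simp add: coeff_sum lookup_sum)
  then show False using zero f(2) by simp
qed

lemma inj_on_normalized_monomial:
  assumes n: "2 \<le> n"
  shows "inj_on (\<lambda>(v, b). normalized_monomial n v b :: 'k::field mpol poly) (monomial_set n d)"
proof -
  have nonneg: "0 \<le> v i + int b" if mem: "(v, b) \<in> monomial_set n d" and i: "i < n" for v b i
  proof -
    obtain \<beta> where \<beta>: "covers n v \<beta>" "(\<Sum>i<n. \<beta> i) = b"
      using mem unfolding monomial_set_def by blast
    have "i \<noteq> cyc_pred n i" using n i by (auto simp: cyc_pred_def)
    then have "\<beta> i + \<beta> (cyc_pred n i) = (\<Sum>j\<in>{i, cyc_pred n i}. \<beta> j)" by simp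
    also have "\<dots> \<le> b" unfolding \<beta>(2)[symmetric]
      using i cyc_pred_less by (intro sum_mono2) auto
    finally show ?thesis using \<beta>(1) i unfolding covers_def by fastforce
  qed
  show ?thesis
  proof (rule inj_onI, clarify)
    fix v b v' b'
    assume mem: "(v, b) \<in> monomial_set n d" "(v', b') \<in> monomial_set n d"
      and "normalized_monomial n v b = (normalized_monomial n v' b' :: 'k mpol poly)"
    then have eq: "(\<Sum>i<n. Poly_Mapping.single i (nat (v i + int b))) =
        (\<Sum>i<n. Poly_Mapping.single i (nat (v' i + int b'))) \<and> b = b'"
      unfolding normalized_monomial_def monomial_eq_iff by blast
    note e = conjunct1[OF eq] and b = conjunct2[OF eq]
    have "v i = v' i" if "i < n" for i
      using arg_cong[OF e, of "\<lambda>m. Poly_Mapping.lookup m i"] that nonneg[OF mem(1) that] nonneg[OF mem(2) that] b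
      unfolding lookup_sum_single by simp
    moreover have "v \<in> PiE {..<n} (\<lambda>_. UNIV)" "v' \<in> PiE {..<n} (\<lambda>_. UNIV)"
      using mem unfolding monomial_set_def by blast+
    ultimately show "v = v' \<and> b = b'" using b PiE_lessThan_eqI by blast
  qed
qed

lemma dim_rees_comp:
  assumes n: "2 \<le> n"
  shows "rees.dim (rees_comp n d :: 'k::field mpol poly set) = card (monomial_set n d)"
proof -
  let ?B = "(\<lambda>(v, b). normalized_monomial n v b :: 'k mpol poly) ` monomial_set n d"
  have "?B \<subseteq> range (\<lambda>(m, b). monomial m b)"
    unfolding normalized_monomial_def by auto
  then have "rees.independent ?B" by (rule rees.independent_mono[OF independent_monomials])
  then have "rees.dim (rees.span ?B) = card ?B" by (rule rees.dim_span_eq_card_independent)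
  also have "rees.span ?B = rees_comp n d"
    unfolding rees_comp_eq_span gprods_eq_normalized_monomials[OF n] ..
  also have "card ?B = card (monomial_set n d)"
    by (rule card_image[OF inj_on_normalized_monomial[OF n]])
  finally show ?thesis .
qed

section \<open>The Hilbert series\<close>

theorem theorem4p6:
  fixes n :: nat
  assumes "n \<ge> 3"
  shows "(\<forall>s. n = 2 * s + 1 \<longrightarrow>
           rees_HS TYPE('k::field) n =
             ((\<Sum>k=0..s - 1. (1 + fps_X) ^ (2 * k + 1) * fps_X ^ (s - 1 - k)) + fps_X ^ s)
             / (1 - fps_X) ^ (2 * s + 2)) \<and>
         (\<forall>s. n = 2 * s \<longrightarrow>
           rees_HS TYPE('k) n =
             (\<Sum>k=0..s - 1. (1 + fps_X) ^ (2 * k) * fps_X ^ (s - 1 - k))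
             / (1 - fps_X) ^ (2 * s + 1))"
proof (intro conjI allI impI)
  have HS: "rees_HS TYPE('k) n = Abs_fps (\<lambda>d. of_nat (card (monomial_set n d)))"
    unfolding rees_HS_def using assms by (simp add: dim_rees_comp)
  have range: "{0..s - 1} = {0..<s}" if "n = 2 * s \<or> n = 2 * s + 1" for s
    using that assms by auto
  {
    fix s assume n: "n = 2 * s + 1"
    let ?N = "(\<Sum>k=0..s - 1. (1 + fps_X) ^ (2 * k + 1) * fps_X ^ (s - 1 - k)) + fps_X ^ s :: rat fps"
    have "(\<Sum>k=0..s - 1. (1 + fps_X) ^ (2 * k + 1) * fps_X ^ (s - 1 - k)) =
        (1 + fps_X) * (\<Sum>k=0..<s. (1 + fps_X) ^ (2 * k) * fps_X ^ (s - 1 - k) :: rat fps)"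
      using range[of s] n by (simp add: sum_distrib_left mult.assoc)
    then have "?N * (1 + fps_X + fps_X ^ 2) =
        (1 + fps_X) * ((1 + fps_X) ^ (2 * s) - fps_X ^ s) + fps_X ^ s * (1 + fps_X + fps_X ^ 2)"
      unfolding hilbert_numerator[symmetric] by (simp only: distrib_right mult.assoc)
    also have "\<dots> = (1 + fps_X) ^ n + fps_X ^ (s + 2)"
      by (simp add: n algebra_simps power2_eq_square)
    finally have num: "?N * (1 + fps_X + fps_X ^ 2) = (1 + fps_X) ^ n + fps_X ^ (s + 2)" .
    have "2 * s + 2 = Suc n" using n by simp
    then show "rees_HS TYPE('k) n = ?N / (1 - fps_X) ^ (2 * s + 2)"
      using fps_eq_quotientI[OF gf_monomial_set_odd[OF n] num] unfolding HS by (simp only:)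
  next
    fix s assume n: "n = 2 * s"
    let ?N = "\<Sum>k=0..s - 1. (1 + fps_X) ^ (2 * k) * fps_X ^ (s - 1 - k) :: rat fps"
    have pos: "0 < n" using assms by simp
    have "?N * (1 + fps_X + fps_X ^ 2) = (1 + fps_X) ^ n - fps_X ^ s"
      using range[of s] n hilbert_numerator[where s = s and z = "fps_X :: rat fps"] by simp
    note num = this
    have "2 * s + 1 = Suc n" using n by simp
    then show "rees_HS TYPE('k) n = ?N / (1 - fps_X) ^ (2 * s + 1)"
      using fps_eq_quotientI[OF gf_monomial_set_even[OF n pos] num] unfolding HS by (simp only:)
  }
qed

end
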